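(* For every perfect matching $M_0$ of $G^+$, the map $\Psi_{M_0}:M(G^+)\to K(G^+)$ is a bijection (and $\Psi_{M_0}(M_0)=0$).
   Context: $G$ is a finite connected planar graph (multi-edges allowed, no loops) with a fixed embedding in the plane, and $q$ is a fixed vertex of $G$ lying on the boundary of the infinite (outer) face. Let $G^\vee$ be the planar dual and $q^*$ the dual vertex of the outer face. Superimpose $G$ and $G^\vee$ so that each edge $e$ of $G$ crosses exactly its dual edge $e^*$, place a new vertex $w_e$ at each crossing, so each edge of $G$ and of $G^\vee$ is split into two half-edges; then delete $q$, $q^*$ and all half-edges incident to them. The resulting planar bipartite graph is $G^+$. Its white vertices are $W=\{w_e: e\in E(G)\}$; its black vertices are the vertices of $G$ other than $q$ and the bounded faces of $G$. Every edge of $G^+$ is a half-edge of an edge of $G$ or of $G^\vee$. $M(G^+)$ is the set of perfect matchings of $G^+$. For a spanning tree $T$ of $G$, the orientation $O_T$ of $G$ orients each edge of $T$ away from $q$ and each edge $e\notin T$ counterclockwise around the unique cycle in $T\cup\{e\}$. Given an orientation $O$ of $G$, the induced orientation $\widehat O$ of $G^+$ is: each half-edge of an edge $e$ of $G$ is oriented in the direction of $e$ in $O$; each half-edge of a dual edge $e^*$ is oriented in the direction of $e^*$, where $e^*$ is oriented as the $90^\circ$ counterclockwise rotation of the $O$-direction of $e$. An edge of $G^+$ is positively oriented if it points from its white endpoint to its black endpoint, negatively oriented otherwise. The Temperley matching $M_T$ consists of, for each $e\in T$, the positively oriented (in $\widehat{O_T}$) half-edge of $e$ at $w_e$, and for each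 $e\notin T$, the positively oriented half-edge of $e^*$ at $w_e$; $T\mapsto M_T$ is a bijection from spanning trees of $G$ to $M(G^+)$. Kasteleyn cokernel: for a $q$-connected orientation $O$ (e.g. $O_T$) and each black vertex $b$ let $r_b\in\mathbb Z^W$ have $w$-coordinate equal to (number of edges between $w$ and $b$ oriented $w\to b$ in $\widehat O$) minus (number oriented $b\to w$). $\mathrm{Prin}(G^+)$ is the subgroup of $\mathbb Z^W$ generated by the $r_b$, and $K(G^+)=\mathbb Z^W/\mathrm{Prin}(G^+)$. For a reference perfect matching $M_0=M_{T_0}$, use the orientation $\widehat{O_{T_0}}$. For $M\in M(G^+)$, $M_0\triangle M$ is a disjoint union of cycles; define $d\in\mathbb Z^W$ by $d(w)=1$ if $w$ lies on $M_0\triangle M$ and its two incident edges in $M_0\triangle M$ have opposite orientations (one positively, one negatively oriented), and $d(w)=0$ otherwise; $\Psi_{M_0}(M)=[d]\in K(G^+)$. *)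

theory Defs
  imports Main
begin

text \<open>A connected plane graph with a fixed embedding is encoded as a combinatorial map
  (rotation system) on a finite set of darts: every edge consists of two darts
  exchanged by the fixed-point free involution alp; sig sends a dart to the next dart
  counterclockwise around its tail vertex.  Vertices are sig-orbits, edges are
  alp-orbits, faces are orbits of alp o sig; a dart d has the face face_of d on its
  left.  Planarity of the embedding is Euler's formula V - E + F = 2.  The record
  also carries the chosen outer face and the chosen root vertex q.\<close>

record 'd emb =
  darts :: "'d set"
  alp :: "'d \<Rightarrow> 'd"
  sig :: "'d \<Rightarrow> 'd"
  outer :: "'d set"
  root :: "'d set"

definition orbit :: "('a \<Rightarrow> 'a) \<Rightarrow> 'a \<Rightarrow> 'a set" where
  "orbit f x = {(f ^^ n) x | n. True}"

definition vert_of :: "'d emb \<Rightarrow> 'd \<Rightarrow> 'd set" where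
  "vert_of G d = orbit (sig G) d"

definition edge_of :: "'d emb \<Rightarrow> 'd \<Rightarrow> 'd set" where
  "edge_of G d = {d, alp G d}"

definition face_of :: "'d emb \<Rightarrow> 'd \<Rightarrow> 'd set" where
  "face_of G d = orbit (alp G \<circ> sig G) d"

definition verts :: "'d emb \<Rightarrow> 'd set set" where
  "verts G = vert_of G ` darts G"

definition edges :: "'d emb \<Rightarrow> 'd set set" where
  "edges G = edge_of G ` darts G"

definition faces :: "'d emb \<Rightarrow> 'd set set" where
  "faces G = face_of G ` darts G"

definition plane_map :: "'d emb \<Rightarrow> bool" where
  "plane_map G \<longleftrightarrow>
     finite (darts G) \<and> darts G \<noteq> {} \<and>
     (\<forall>d\<in>darts G. alp G d \<in> darts G \<and> alp G d \<noteq> d \<and> alp G (alp G d) = d) \<and>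
     bij_betw (sig G) (darts G) (darts G) \<and>
     (\<forall>d\<in>darts G. \<forall>d'\<in>darts G.
        (d, d') \<in> {(x, y). x \<in> darts G \<and> (y = alp G x \<or> y = sig G x)}\<^sup>*) \<and>
     (\<forall>d\<in>darts G. alp G d \<notin> vert_of G d) \<and>
     int (card (verts G)) - int (card (edges G)) + int (card (faces G)) = 2"

text \<open>q lies on the boundary of the outer face.\<close>
definition plane_graph :: "'d emb \<Rightarrow> bool" where
  "plane_graph G \<longleftrightarrow> plane_map G \<and>
     (\<exists>d\<in>darts G. vert_of G d = root G \<and> face_of G d = outer G)"

subsection \<open>Spanning trees\<close>

definition tree_rel :: "'d emb \<Rightarrow> 'd set set \<Rightarrow> ('d set \<times> 'd set) set" where
  "tree_rel G T = {(vert_of G d, vert_of G (alp G d)) | d. d \<in> darts G \<and> edge_of G d \<in> T}"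

definition conn :: "'d emb \<Rightarrow> 'd set set \<Rightarrow> 'd set \<Rightarrow> 'd set \<Rightarrow> bool" where
  "conn G T u v \<longleftrightarrow> (u, v) \<in> (tree_rel G T)\<^sup>*"

text \<open>Spanning tree: spanning connected edge set without cycles (no edge of T has its
  endpoints connected in T minus that edge).\<close>
definition spanning_tree :: "'d emb \<Rightarrow> 'd set set \<Rightarrow> bool" where
  "spanning_tree G T \<longleftrightarrow> T \<subseteq> edges G \<and>
     (\<forall>u\<in>verts G. \<forall>v\<in>verts G. conn G T u v) \<and>
     (\<forall>d\<in>darts G. edge_of G d \<in> T \<longrightarrow>
        \<not> conn G (T - {edge_of G d}) (vert_of G d) (vert_of G (alp G d)))"

text \<open>Edges of the tree path between u and v.\<close>
definition tree_path_edges :: "'d emb \<Rightarrow> 'd set set \<Rightarrow> 'd set \<Rightarrow> 'd set \<Rightarrow> 'd set set" where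
  "tree_path_edges G T u v = {t \<in> T. \<not> conn G (T - {t}) u v}"

text \<open>Unique cycle in T plus the edge of d.\<close>
definition fund_cycle :: "'d emb \<Rightarrow> 'd set set \<Rightarrow> 'd \<Rightarrow> 'd set set" where
  "fund_cycle G T d = insert (edge_of G d) (tree_path_edges G T (vert_of G (alp G d)) (vert_of G d))"

text \<open>Adjacency of faces in the dual graph, using only dual edges of edges outside C.\<close>
definition dual_rel :: "'d emb \<Rightarrow> 'd set set \<Rightarrow> ('d set \<times> 'd set) set" where
  "dual_rel G C = {(face_of G d, face_of G (alp G d)) | d. d \<in> darts G \<and> edge_of G d \<notin> C}"

text \<open>The orientation O_T, as the set of darts giving the direction of each edge.
  A tree edge is oriented away from q; a non-tree edge d is oriented counterclockwise
  around its fundamental cycle, i.e. the face on the left of d lies in the bounded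
  region enclosed by the cycle (it is separated from the outer face).\<close>
definition tree_orient :: "'d emb \<Rightarrow> 'd set set \<Rightarrow> 'd set" where
  "tree_orient G T = {d \<in> darts G.
     if edge_of G d \<in> T then conn G (T - {edge_of G d}) (root G) (vert_of G d)
     else (face_of G d, outer G) \<notin> (dual_rel G (fund_cycle G T d))\<^sup>*}"

subsection \<open>The graph G+\<close>

datatype hk = Prim | Dual
datatype 'a blk = BV 'a | BF 'a

text \<open>Edge (d, Prim): primal half-edge between w_e and the tail of d;
  edge (d, Dual): dual half-edge between w_e and the face on the left of d.\<close>
definition plus_edges :: "'d emb \<Rightarrow> ('d \<times> hk) set" where
  "plus_edges G = {(d, Prim) | d. d \<in> darts G \<and> vert_of G d \<noteq> root G}
                \<union> {(d, Dual) | d. d \<in> darts G \<and> face_of G d \<noteq> outer G}"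

definition white_end :: "'d emb \<Rightarrow> 'd \<times> hk \<Rightarrow> 'd set" where
  "white_end G g = edge_of G (fst g)"

definition black_end :: "'d emb \<Rightarrow> 'd \<times> hk \<Rightarrow> 'd set blk" where
  "black_end G g = (case snd g of Prim \<Rightarrow> BV (vert_of G (fst g)) | Dual \<Rightarrow> BF (face_of G (fst g)))"

definition white_verts :: "'d emb \<Rightarrow> 'd set set" where
  "white_verts G = edges G"

definition black_verts :: "'d emb \<Rightarrow> 'd set blk set" where
  "black_verts G = BV ` (verts G - {root G}) \<union> BF ` (faces G - {outer G})"

definition perfect_matching :: "'d emb \<Rightarrow> ('d \<times> hk) set \<Rightarrow> bool" where
  "perfect_matching G M \<longleftrightarrow> M \<subseteq> plus_edges G \<and>
     (\<forall>w\<in>white_verts G. \<exists>!g. g \<in> M \<and> white_end G g = w) \<and>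
     (\<forall>b\<in>black_verts G. \<exists>!g. g \<in> M \<and> black_end G g = b)"

definition perfect_matchings :: "'d emb \<Rightarrow> ('d \<times> hk) set set" where
  "perfect_matchings G = {M. perfect_matching G M}"

text \<open>Positivity (pointing white to black) of an edge of G+ in the orientation induced
  by the orientation Or of G (Or = set of darts giving the edge directions; the dual
  edge is the 90 degree counterclockwise rotation, i.e. from right face to left face).\<close>
definition is_pos :: "'d set \<Rightarrow> 'd \<times> hk \<Rightarrow> bool" where
  "is_pos Or g = (case snd g of Prim \<Rightarrow> fst g \<notin> Or | Dual \<Rightarrow> fst g \<in> Or)"

text \<open>Temperley matching M_T.\<close>
definition temperley :: "'d emb \<Rightarrow> 'd set set \<Rightarrow> ('d \<times> hk) set" where
  "temperley G T = {g \<in> plus_edges G. is_pos (tree_orient G T) g \<and>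
      (if white_end G g \<in> T then snd g = Prim else snd g = Dual)}"

subsection \<open>Kasteleyn cokernel\<close>

definition kast_row :: "'d emb \<Rightarrow> 'd set \<Rightarrow> 'd set blk \<Rightarrow> 'd set \<Rightarrow> int" where
  "kast_row G Or b w = (\<Sum>g\<in>{g \<in> plus_edges G. white_end G g = w \<and> black_end G g = b}.
                          if is_pos Or g then 1 else -1)"

definition ZW :: "'d emb \<Rightarrow> ('d set \<Rightarrow> int) set" where
  "ZW G = {x. \<forall>w. w \<notin> white_verts G \<longrightarrow> x w = 0}"

definition Prin :: "'d emb \<Rightarrow> 'd set \<Rightarrow> ('d set \<Rightarrow> int) set" where
  "Prin G Or = {x. \<exists>c :: 'd set blk \<Rightarrow> int.
                  x = (\<lambda>w. \<Sum>b\<in>black_verts G. c b * kast_row G Or b w)}"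

definition krel :: "'d emb \<Rightarrow> 'd set \<Rightarrow> (('d set \<Rightarrow> int) \<times> ('d set \<Rightarrow> int)) set" where
  "krel G Or = {(x, y). x \<in> ZW G \<and> y \<in> ZW G \<and> (\<lambda>w. x w - y w) \<in> Prin G Or}"

definition kcoker :: "'d emb \<Rightarrow> 'd set \<Rightarrow> ('d set \<Rightarrow> int) set set" where
  "kcoker G Or = ZW G // krel G Or"

definition matched :: "'d emb \<Rightarrow> ('d \<times> hk) set \<Rightarrow> 'd set \<Rightarrow> 'd \<times> hk" where
  "matched G M w = (THE g. g \<in> M \<and> white_end G g = w)"

text \<open>The vector d of the definition of Psi: w lies on M0 symmetric-difference M iff its
  M0-edge and M-edge differ; these are then its two incident edges there.\<close>
definition psi_vec :: "'d emb \<Rightarrow> 'd set \<Rightarrow> ('d \<times> hk) set \<Rightarrow> ('d \<times> hk) set \<Rightarrow> 'd set \<Rightarrow> int" where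
  "psi_vec G Or M0 M w = (if w \<in> white_verts G \<and> matched G M0 w \<noteq> matched G M w \<and>
        is_pos Or (matched G M0 w) \<noteq> is_pos Or (matched G M w) then 1 else 0)"

text \<open>Psi_{M0} for M0 = M_{T0}, using the orientation induced by O_{T0}.\<close>
definition Psi :: "'d emb \<Rightarrow> 'd set set \<Rightarrow> ('d \<times> hk) set \<Rightarrow> ('d set \<Rightarrow> int) set" where
  "Psi G T0 M = krel G (tree_orient G T0) `` {psi_vec G (tree_orient G T0) (temperley G T0) M}"

end

theory Submission
  imports Defs
begin

text \<open>
  A perfect matching M is a pair (P, Q) of dart sets: P holds the darts of the primal half-edges
  of M, indexed by the vertices other than q, and Q those of the dual half-edges, indexed by the
  bounded faces. Declaring all edges of M positive defines an orientation O(M), and Psi(M) is the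
  class of the set of edges on which O(M) and the reference orientation differ. In terms of chains,
  the cokernel is the quotient of the integer 1-chains by cuts (coboundaries of vertex functions) plus
  cycles (coboundaries of face functions), which are orthogonal.

  Trees: P and Q are arborescences rooted at q and at the outer face. Indeed the tour around the tree
  component of q, started at a corner of q in the outer face, visits every corner of that component,
  and dually; so the two root components share all their corners and are everything by connectedness.

  Injectivity: if O(M') - O(M) is the coboundary of g plus that of h, then, by orthogonality, all
  edges of the cut around a maximal level set of g avoiding q leave that set in O(M), so the set cannot
  be reached from q. Hence g, and dually h, is constant and O(M) = O(M'). The tour argument,
  applied to the common parts of the two tree pairs, then gives M = M'.

  Surjectivity: among the chains of a class, one of minimal distance to the orientations is an
  orientation, since every edge lies on a directed cut or a directed cycle. Reversing directed cuts
  and cycles enlarges the sets of vertices and faces reachable from the roots until they are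
  everything, and such an orientation is O(M) for the M obtained by greedily growing the two
  arborescences at corners belonging to both.
\<close>

section \<open>Circulations and tours on combinatorial maps\<close>

text \<open>Head minus tail. With vertices as \<open>t\<close> these chains are the integer
  combinations of cuts, with left faces the combinations of face boundaries; so one definition
  serves cuts and cycles.\<close>

definition cob :: "('d \<Rightarrow> 'd) \<Rightarrow> ('d \<Rightarrow> 'v) \<Rightarrow> ('v \<Rightarrow> int) \<Rightarrow> 'd \<Rightarrow> int" where
  "cob a t g d = g (t (a d)) - g (t d)"

definition circ :: "'d set \<Rightarrow> ('d \<Rightarrow> 'd) \<Rightarrow> ('d \<Rightarrow> 'v) \<Rightarrow> ('d \<Rightarrow> int) \<Rightarrow> bool" where
  "circ D a t c \<longleftrightarrow> (\<forall>d\<in>D. c (a d) = - c d) \<and> (\<forall>v. (\<Sum>d\<in>{d\<in>D. t d = v}. c d) = 0)"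

text \<open>A dart d in B is a step from the head to the tail of d.\<close>
inductive_set reach :: "('d \<Rightarrow> 'd) \<Rightarrow> ('d \<Rightarrow> 'v) \<Rightarrow> 'v \<Rightarrow> 'd set \<Rightarrow> 'v set"
  for a t r B where
  root: "r \<in> reach a t r B"
| step: "d \<in> B \<Longrightarrow> t (a d) \<in> reach a t r B \<Longrightarrow> t d \<in> reach a t r B"

section \<open>Reachability from a root\<close>

lemma reach_cases: "v \<in> reach a t r B \<Longrightarrow> v = r \<or> (\<exists>d\<in>B. v = t d \<and> t (a d) \<in> reach a t r B)"
  by (erule reach.cases) auto

text \<open>Injectivity of \<open>t\<close> makes \<open>d\<close> the only step ending at
  \<open>t d\<close>, so a walk to that vertex arrives from its parent
  \<open>t (a d)\<close>.\<close>

lemma reach_parent: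
  assumes "d \<in> B" "inj_on t B" "r \<notin> t ` B" "t d \<in> reach a t r B"
  shows "t (a d) \<in> reach a t r B"
  using reach_cases[OF assms(4)] assms by (metis imageI inj_onD)

lemma reach_mono_on:
  assumes "\<And>d. d \<in> B \<Longrightarrow> t (a d) \<in> reach a t r C \<Longrightarrow> t d \<in> reach a t r C"
  shows "reach a t r B \<subseteq> reach a t r C"
proof
  fix v assume "v \<in> reach a t r B"
  then show "v \<in> reach a t r C" by induction (auto intro: reach.root assms)
qed

lemma reach_exit:
  assumes "v \<in> reach a t r B" "v \<in> A" "r \<notin> A"
  obtains d where "d \<in> B" "t d \<in> A" "t (a d) \<notin> A"
proof -
  have "v \<in> A \<longrightarrow> (\<exists>d\<in>B. t d \<in> A \<and> t (a d) \<notin> A)"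
    using assms(1) by induction (use assms(3) in auto)
  then show ?thesis using that assms(2) by blast
qed

text \<open>t d is the tail vertex and l d the left face of the dart d; the darts are also the corners, d
  being the corner between d and s d. The axioms are invariant under duality: s becomes a o s,
  and t and l are exchanged. Orientations are then replaced by their complements.\<close>
locale cmap =
  fixes D :: "'d set" and a s :: "'d \<Rightarrow> 'd" and t :: "'d \<Rightarrow> 'v" and l :: "'d \<Rightarrow> 'f" and d0 :: 'd
  assumes fin: "finite D"
    and a_in [simp]: "d \<in> D \<Longrightarrow> a d \<in> D"
    and a_ne [simp]: "d \<in> D \<Longrightarrow> a d \<noteq> d"
    and a_inv [simp]: "d \<in> D \<Longrightarrow> a (a d) = d"
    and s_bij: "bij_betw s D D"
    and t_s: "d \<in> D \<Longrightarrow> t (s d) = t d"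
    and l_as: "d \<in> D \<Longrightarrow> l (a (s d)) = l d"
    and t_orb: "\<lbrakk>X \<subseteq> D; \<And>d. d \<in> X \<Longrightarrow> s d \<in> X; d \<in> X; d' \<in> D; t d' = t d\<rbrakk> \<Longrightarrow> d' \<in> X"
    and l_orb: "\<lbrakk>X \<subseteq> D; \<And>d. d \<in> X \<Longrightarrow> a (s d) \<in> X; d \<in> X; d' \<in> D; l d' = l d\<rbrakk> \<Longrightarrow> d' \<in> X"
    and connected: "\<lbrakk>X \<subseteq> D; X \<noteq> {}; \<And>d. d \<in> X \<Longrightarrow> a d \<in> X; \<And>d. d \<in> X \<Longrightarrow> s d \<in> X\<rbrakk> \<Longrightarrow> X = D"
    and d0_in [simp]: "d0 \<in> D"
begin

abbreviation "V \<equiv> t ` D"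
abbreviation "F \<equiv> l ` D"
abbreviation "reachV \<equiv> reach a t (t d0)"
abbreviation "reachF \<equiv> reach a l (l d0)"

lemma s_in [simp]: "d \<in> D \<Longrightarrow> s d \<in> D"
  using s_bij by (auto simp: bij_betw_def)

lemma a_bij: "bij_betw a D D"
  by (rule bij_betw_byWitness[where f'=a]) auto

text \<open>Turning around the left face is the rotation of the dual map, and
  \<open>a (a (s d)) = s d\<close> makes this an involution. Each result on vertices thereby yields
  one on faces.\<close>

lemma dual: "cmap D a (\<lambda>d. a (s d)) l t d0"
proof
  show "bij_betw (\<lambda>d. a (s d)) D D"
    using bij_betw_trans[OF s_bij a_bij] by (simp add: comp_def)
  show "t (a (a (s d))) = t d" if "d \<in> D" for d using that by (simp add: t_s)
  show "d' \<in> X" if "X \<subseteq> D" "\<And>d. d \<in> X \<Longrightarrow> a (a (s d)) \<in> X" "d \<in> X" "d' \<in> D" "t d' = t d" for X d d'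
    by (rule t_orb[of X d]) (use that in \<open>auto simp: subset_iff\<close>)
  show "X = D" if X: "X \<subseteq> D" "X \<noteq> {}" "\<And>d. d \<in> X \<Longrightarrow> a d \<in> X" "\<And>d. d \<in> X \<Longrightarrow> a (s d) \<in> X" for X
  proof (rule connected[OF X(1-3)])
    fix d assume "d \<in> X"
    then have "a (a (s d)) \<in> X" "d \<in> D" using X by auto
    then show "s d \<in> X" by simp
  qed
qed (fact l_orb | simp add: fin l_as)+

section \<open>Orthogonality of cuts and cycles\<close>

definition si where "si = inv_into D s"

lemma si_in [simp]: "d \<in> D \<Longrightarrow> si d \<in> D"
  and s_si [simp]: "d \<in> D \<Longrightarrow> s (si d) = d"
  and si_s [simp]: "d \<in> D \<Longrightarrow> si (s d) = d"
  using s_bij by (auto simp: si_def bij_betw_def inv_into_into f_inv_into_f)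

lemma t_si [simp]: "d \<in> D \<Longrightarrow> t (si d) = t d"
  using t_s[of "si d"] by simp

text \<open>Crossing \<open>d\<close> clockwise around its tail leads to the corner
  \<open>si d\<close>, hence to the face on the right of \<open>d\<close>. Sums around a vertex and
  the tour both rest on this.\<close>

lemma l_si [simp]: "d \<in> D \<Longrightarrow> l (si d) = l (a d)"
  using l_as[of "si d"] by simp

lemma sum_si: "(\<Sum>d\<in>{d\<in>D. t d = v}. f (si d)) = (\<Sum>d\<in>{d\<in>D. t d = v}. f d)"
  by (rule sum.reindex_bij_witness[of _ s si]) (auto simp: t_s)

lemma sum_a: "(\<Sum>d\<in>D. f (a d)) = (\<Sum>d\<in>D. f d)"
  by (rule sum.reindex_bij_witness[of _ a a]) auto

text \<open>By \<open>l_si\<close> the jump across \<open>d\<close> is a difference of values at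
  consecutive corners, so it telescopes around a vertex.\<close>

lemma circ_cob_l: "circ D a t (cob a l h)"
proof -
  have "(\<Sum>d\<in>{d\<in>D. t d = v}. cob a l h d) = 0" for v
  proof -
    have "(\<Sum>d\<in>{d\<in>D. t d = v}. cob a l h d) = (\<Sum>d\<in>{d\<in>D. t d = v}. h (l (si d)) - h (l d))"
      by (rule sum.cong) (auto simp: cob_def)
    also have "\<dots> = 0"
      unfolding sum_subtractf using sum_si[of "\<lambda>d. h (l d)" v] by simp
    finally show ?thesis .
  qed
  then show ?thesis by (auto simp: circ_def cob_def)
qed

lemma sum_by_t: "(\<Sum>d\<in>D. f d) = (\<Sum>v\<in>V. \<Sum>d\<in>{d\<in>D. t d = v}. f d)" for f :: "'d \<Rightarrow> int"
  by (rule sum.image_gen[OF fin])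

text \<open>Summation by parts: grouped by tails, the terms \<open>c d * g (t d)\<close> vanish by
  conservation, and replacing \<open>d\<close> by \<open>a d\<close> reduces the head terms to
  these.\<close>

lemma circ_orth_cob:
  assumes "circ D a t c"
  shows "(\<Sum>d\<in>D. c d * cob a t g d) = 0"
proof -
  have 1: "(\<Sum>d\<in>D. c d * g (t d)) = 0"
  proof -
    have "(\<Sum>d\<in>{d\<in>D. t d = v}. c d * g (t d)) = (\<Sum>d\<in>{d\<in>D. t d = v}. c d) * g v" for v
      unfolding sum_distrib_right by (rule sum.cong) auto
    then show ?thesis using assms unfolding sum_by_t circ_def by simp
  qed
  have "(\<Sum>d\<in>D. c d * g (t (a d))) = (\<Sum>d\<in>D. c (a (a d)) * g (t (a d)))"
    by (rule sum.cong) auto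
  also have "\<dots> = (\<Sum>d\<in>D. c (a d) * g (t d))"
    using sum_a[of "\<lambda>d. c (a d) * g (t d)"] by simp
  also have "\<dots> = (\<Sum>d\<in>D. - (c d * g (t d)))"
    by (rule sum.cong) (use assms in \<open>auto simp: circ_def\<close>)
  finally have "(\<Sum>d\<in>D. c d * g (t (a d))) = 0" using 1 by (simp add: sum_negf)
  then show ?thesis using 1 by (simp add: cob_def right_diff_distrib sum_subtractf)
qed

text \<open>On the set of vertices whose tree edge carries flow, choosing a child that carries flow is
  injective, hence surjective: the set is closed under taking parents, yet avoids the root.\<close>
lemma tree_flow_zero:
  assumes P: "P \<subseteq> D" "inj_on t P" "t d0 \<notin> t ` P"
    and anti: "\<And>d. d \<in> D \<Longrightarrow> c (a d) = - c d"
    and cons: "\<And>v. v \<in> reachV P \<Longrightarrow> (\<Sum>d\<in>{d\<in>D. t d = v}. c d) = (0::int)"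
    and supp: "\<And>d. \<lbrakk>d \<in> D; t d \<in> reachV P; d \<notin> P; a d \<notin> P\<rbrakk> \<Longrightarrow> c d = 0"
    and d: "d \<in> D" "t d \<in> reachV P"
  shows "c d = 0"
proof -
  define N where "N = {d\<in>P. t d \<in> reachV P \<and> c d \<noteq> 0}"
  have finN: "finite N" using fin P(1) by (auto simp: N_def intro: finite_subset)
  have "\<exists>e\<in>N. t (a e) = t d" if "d \<in> N" for d
  proof -
    have d: "d \<in> P" "d \<in> D" "t d \<in> reachV P" "c d \<noteq> 0" using that P(1) by (auto simp: N_def)
    have "\<exists>e\<in>{e\<in>D. t e = t d} - {d}. c e \<noteq> 0"
    proof (rule ccontr)
      assume "\<not> ?thesis"
      then have "(\<Sum>e\<in>{e\<in>D. t e = t d} - {d}. c e) = 0" by (intro sum.neutral) auto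
      moreover have "(\<Sum>e\<in>{e\<in>D. t e = t d}. c e) = c d + (\<Sum>e\<in>{e\<in>D. t e = t d} - {d}. c e)"
        by (rule sum.remove) (use d fin in auto)
      ultimately show False using cons[OF d(3)] d(4) by simp
    qed
    then obtain e where e: "e \<in> D" "t e = t d" "e \<noteq> d" "c e \<noteq> 0" by auto
    have "e \<notin> P" using e d P(2) by (auto dest: inj_onD)
    then have "a e \<in> P" using supp[of e] e d by auto
    moreover have "t (a e) \<in> reachV P"
      by (rule reach.step) (use \<open>a e \<in> P\<close> e d in auto)
    ultimately have "a e \<in> N" using e anti[of e] by (auto simp: N_def)
    then show ?thesis using e by (intro bexI[of _ "a e"]) auto
  qed
  then obtain f where f: "\<And>d. d \<in> N \<Longrightarrow> f d \<in> N \<and> t (a (f d)) = t d" by metis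
  have "inj_on f N"
  proof (rule inj_onI)
    fix x y assume "x \<in> N" "y \<in> N" "f x = f y"
    then have "t x = t y" using f by metis
    then show "x = y" using \<open>x \<in> N\<close> \<open>y \<in> N\<close> P(2) by (auto simp: N_def dest: inj_onD)
  qed
  then have surj: "f ` N = N" using finN f by (intro endo_inj_surj) auto
  have "v \<in> reachV P \<Longrightarrow> v \<notin> t ` N" for v
  proof (induction rule: reach.induct)
    case root
    then show ?case using P(3) by (auto simp: N_def)
  next
    case (step d)
    show ?case
    proof
      assume "t d \<in> t ` N"
      then have "d \<in> N" using step(1) P(2) by (auto simp: N_def dest: inj_onD)
      then obtain e where "e \<in> N" "d = f e" using surj by auto
      then have "t (a d) = t e" using f by auto
      then show False using step \<open>e \<in> N\<close> by auto
    qed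
  qed
  then have z: "c e = 0" if "e \<in> P" "t e \<in> reachV P" for e
    using that by (auto simp: N_def)
  show ?thesis
  proof (cases "d \<in> P")
    case True
    then show ?thesis using z d by auto
  next
    case False
    then show ?thesis
    proof (cases "a d \<in> P")
      case True
      have "t (a d) \<in> reachV P" by (rule reach.step) (use True d in auto)
      then have "c (a d) = 0" using z True by auto
      then show ?thesis using anti[of d] d by auto
    qed (use supp d in auto)
  qed
qed

text \<open>X is the tour around the tree component of the root, started at the corner d0. The difference
  between the indicators of X on the two sides of a dart is a circulation on the tree, hence zero, so
  X contains all corners at the vertices of the component.\<close>
lemma tour_half:
  assumes P: "P \<subseteq> D" "inj_on t P" "t d0 \<notin> t ` P"
    and Q: "Q \<subseteq> D" "inj_on l Q" "l d0 \<notin> l ` Q"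
    and decided: "\<And>d. \<lbrakk>d \<in> D; t d \<in> reachV P; l d \<in> reachF Q\<rbrakk> \<Longrightarrow> d \<in> P \<or> a d \<in> P \<or> d \<in> Q \<or> a d \<in> Q"
    and d: "d \<in> D" "t d \<in> reachV P"
  shows "l d \<in> reachF Q"
proof -
  define T where "T d \<longleftrightarrow> d \<in> P \<or> a d \<in> P" for d
  \<comment> \<open>From the corner \<open>d\<close> the tour walks along a tree edge
    \<open>d\<close>, keeping the face, and crosses any other edge \<open>d\<close>, keeping the
    vertex; in either case \<open>si\<close> selects the next corner.\<close>
  define \<rho> where "\<rho> d = si (if T d then a d else d)" for d
  have Ta: "T (a d) \<longleftrightarrow> T d" if "d \<in> D" for d using that by (auto simp: T_def)
  have \<rho>_in: "\<rho> d \<in> D" if "d \<in> D" for d using that by (auto simp: \<rho>_def)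
  have si_inj: "x = y" if "si x = si y" "x \<in> D" "y \<in> D" for x y using that by (metis s_si)
  have \<rho>_inj: "inj_on \<rho> D"
  proof (rule inj_onI)
    fix x y assume xy: "x \<in> D" "y \<in> D" "\<rho> x = \<rho> y"
    have "(if T x then a x else x) = (if T y then a y else y)"
      by (rule si_inj) (use xy in \<open>auto simp: \<rho>_def\<close>)
    then show "x = y" using xy Ta by (metis a_inv)
  qed
  define X where "X = {d. (d0, d) \<in> {(x, \<rho> x) |x. True}\<^sup>*}"
  have d0X: "d0 \<in> X" by (simp add: X_def)
  have X\<rho>: "\<rho> d \<in> X" if "d \<in> X" for d
    using that unfolding X_def mem_Collect_eq by (rule rtrancl_into_rtrancl) simp
  have X_sub: "d \<in> D \<and> t d \<in> reachV P \<and> l d \<in> reachF Q" if "d \<in> X" for d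
  proof -
    have "(d0, d) \<in> {(x, \<rho> x) |x. True}\<^sup>*" using that by (simp add: X_def)
    then show ?thesis
    proof (induction rule: rtrancl_induct)
      case base
      then show ?case by (auto intro: reach.root)
    next
      case (step x y)
      then have y: "y = \<rho> x" and x: "x \<in> D" "t x \<in> reachV P" "l x \<in> reachF Q" by auto
      show ?case
      proof (cases "T x")
        case True
        have "t (a x) \<in> reachV P"
        proof (cases "x \<in> P")
          case True
          then show ?thesis using reach_parent[of x P t "t d0" a] P x by auto
        next
          case False
          then have "a x \<in> P" using \<open>T x\<close> by (auto simp: T_def)
          then show ?thesis by (rule reach.step) (use x in auto)
        qed
        then show ?thesis using True x by (auto simp: y \<rho>_def)
      next
        case False
        then have *: "x \<in> Q \<or> a x \<in> Q" using decided[of x] x by (auto simp: T_def)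
        have "l (a x) \<in> reachF Q"
        proof (cases "x \<in> Q")
          case True
          then show ?thesis using reach_parent[of x Q l "l d0" a] Q x by auto
        next
          case False
          then have "a x \<in> Q" using * by auto
          then show ?thesis by (rule reach.step) (use x in auto)
        qed
        then show ?thesis using False x by (auto simp: y \<rho>_def)
      qed
    qed
  qed
  have XD: "X \<subseteq> D" using X_sub by auto
  \<comment> \<open>An injection of a finite set into itself is onto, so the tour closes up and
    membership in \<open>X\<close> can be pulled back along \<open>\<rho>\<close>.\<close>
  have surj: "\<rho> ` X = X"
    by (rule endo_inj_surj) (use X\<rho> fin XD \<rho>_inj in \<open>auto intro: finite_subset inj_on_subset\<close>)
  have X_iff: "\<rho> d \<in> X \<longleftrightarrow> d \<in> X" if "d \<in> D" for d
  proof
    assume "\<rho> d \<in> X"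
    then obtain e where "e \<in> X" "\<rho> d = \<rho> e" using surj by (metis imageE)
    then show "d \<in> X" using inj_onD[OF \<rho>_inj, of d e] that XD by auto
  qed (rule X\<rho>)
  have si_T: "si d \<in> X \<longleftrightarrow> a d \<in> X" if "d \<in> D" "T d" for d
    using X_iff[of "a d"] that Ta[of d] by (simp add: \<rho>_def)
  have si_nT: "si d \<in> X \<longleftrightarrow> d \<in> X" if "d \<in> D" "\<not> T d" for d
    using X_iff[of "d"] that by (simp add: \<rho>_def)
  define c where "c d = (of_bool (d \<in> X) - of_bool (si d \<in> X) :: int)" for d
  have c0: "c d = 0" if d: "d \<in> D" "t d \<in> reachV P" for d
  proof (rule tree_flow_zero[OF P _ _ _ d])
    show "c (a d) = - c d" if "d \<in> D" for d
      using that si_T[of d] si_nT[of d] si_T[of "a d"] si_nT[of "a d"] Ta[of d]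
      by (cases "T d") (auto simp: c_def)
    show "(\<Sum>d\<in>{d\<in>D. t d = v}. c d) = 0" for v
      unfolding c_def sum_subtractf using sum_si[of "\<lambda>d. of_bool (d \<in> X) :: int" v] by simp
    show "c d = 0" if "d \<in> D" "d \<notin> P" "a d \<notin> P" for d
      using that si_nT[of d] by (auto simp: c_def T_def)
  qed
  have si_X: "si d \<in> X \<longleftrightarrow> d \<in> X" if "d \<in> D" "t d \<in> reachV P" for d
    using that c0[of d] by (auto simp: c_def of_bool_def split: if_splits)
  have sX: "s d \<in> X" if "d \<in> X" for d
    using si_X[of "s d"] X_sub[OF that] that t_s[of d] by auto
  have vX: "d' \<in> X" if "d \<in> X" "d' \<in> D" "t d' = t d" for d d'
    by (rule t_orb[OF XD sX]) (use that in auto)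
  have "\<forall>d\<in>D. t d = v \<longrightarrow> d \<in> X" if "v \<in> reachV P" for v
    using that
  proof induction
    case root
    then show ?case using vX d0X by auto
  next
    case (step e)
    then have e: "e \<in> D" "a e \<in> X" using P by auto
    have "T e" using step by (auto simp: T_def)
    then have "e \<in> X" using si_T[of e] si_X[of e] e reach.step[OF step(1,2)] by auto
    then show ?case using vX by auto
  qed
  then show ?thesis using d X_sub by auto
qed

lemmas tour_half_dual = cmap.tour_half[OF dual]

lemma tour:
  assumes P: "P \<subseteq> D" "inj_on t P" "t d0 \<notin> t ` P"
    and Q: "Q \<subseteq> D" "inj_on l Q" "l d0 \<notin> l ` Q"
    and decided: "\<And>d. \<lbrakk>d \<in> D; t d \<in> reachV P; l d \<in> reachF Q\<rbrakk> \<Longrightarrow> d \<in> P \<or> a d \<in> P \<or> d \<in> Q \<or> a d \<in> Q"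
  shows "V \<subseteq> reachV P" "F \<subseteq> reachF Q"
proof -
  have 1: "l d \<in> reachF Q" if "d \<in> D" "t d \<in> reachV P" for d
    by (rule tour_half[OF P Q]) (use decided that in auto)
  have 2: "t d \<in> reachV P" if "d \<in> D" "l d \<in> reachF Q" for d
    by (rule tour_half_dual[OF Q P]) (use decided that in auto)
  let ?Y = "{d\<in>D. t d \<in> reachV P}"
  have "?Y = D"
  proof (rule connected)
    show "?Y \<noteq> {}" using d0_in reach.root[of "t d0" a t P] by blast
    \<comment> \<open>The corner \<open>si d\<close> shares its vertex with \<open>d\<close> and its
      face with \<open>a d\<close>. So the first half reaches this face, and then the second half
      reaches \<open>t (a d)\<close>.\<close>
    show "a d \<in> ?Y" if "d \<in> ?Y" for d
      using that 1[of "si d"] 2[of "a d"] by auto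
  qed (auto simp: t_s)
  then show "V \<subseteq> reachV P" "F \<subseteq> reachF Q" using 1 by auto
qed

end

section \<open>Perfect matchings as pairs of arborescences\<close>

text \<open>The sum of \<open>z\<close> along the tree path from the root. It is a relation because
  such a path is unique only under the hypotheses of \<open>tree_value_unique\<close>.\<close>

inductive tree_value :: "('d \<Rightarrow> 'd) \<Rightarrow> ('d \<Rightarrow> 'v) \<Rightarrow> 'v \<Rightarrow> 'd set \<Rightarrow> ('d \<Rightarrow> int) \<Rightarrow> 'v \<Rightarrow> int \<Rightarrow> bool"
  for a t r B z where
  root: "tree_value a t r B z r 0"
| step: "d \<in> B \<Longrightarrow> tree_value a t r B z (t (a d)) k \<Longrightarrow> tree_value a t r B z (t d) (k + z d)"

lemma tree_value_unique:
  assumes "inj_on t B" "r \<notin> t ` B" "tree_value a t r B z v k" "tree_value a t r B z v k'"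
  shows "k = k'"
  using assms(3,4)
proof (induction arbitrary: k' rule: tree_value.induct)
  case root
  then show ?case by (cases rule: tree_value.cases) (use assms(2) in auto)
next
  case (step d k)
  from step.prems show ?case
  proof (cases rule: tree_value.cases)
    case root
    then show ?thesis using step.hyps(1) assms(2) by auto
  next
    case (step e j)
    then have "e = d" using \<open>d \<in> B\<close> assms(1) by (auto dest: inj_onD)
    then show ?thesis using step step.IH by auto
  qed
qed

lemma tree_potential:
  assumes "inj_on t B" "r \<notin> t ` B"
  shows "\<exists>g. \<forall>d\<in>B. t d \<in> reach a t r B \<longrightarrow> g (t d) - g (t (a d)) = (z d :: int)"
proof (intro exI ballI impI)
  let ?p = "tree_value a t r B z"
  define g where "g v = (THE k. ?p v k)" for v
  have ex: "\<exists>k. ?p v k" if "v \<in> reach a t r B" for v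
    using that by induction (auto intro: tree_value.intros)
  have g: "g v = k" if "?p v k" for v k
    unfolding g_def using that tree_value_unique[OF assms] by blast
  fix d assume d: "d \<in> B" "t d \<in> reach a t r B"
  then have "t (a d) \<in> reach a t r B" using reach_parent[of d B t r a] assms by auto
  then obtain k where k: "?p (t (a d)) k" using ex by auto
  show "g (t d) - g (t (a d)) = z d"
    using g[OF k] g[OF tree_value.step[OF d(1) k]] by simp
qed

definition orient :: "'d set \<Rightarrow> ('d \<Rightarrow> 'd) \<Rightarrow> 'd set \<Rightarrow> bool" where
  "orient D a U \<longleftrightarrow> U \<subseteq> D \<and> (\<forall>d\<in>D. a d \<in> U \<longleftrightarrow> d \<notin> U)"

context cmap
begin

text \<open>Injectivity and the images say that each black vertex is matched exactly once; the
  remaining conditions choose exactly one of the four half-edges at each white vertex.\<close>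

definition pm where
  "pm P Q \<longleftrightarrow> P \<subseteq> D \<and> Q \<subseteq> D \<and> inj_on t P \<and> t ` P = V - {t d0} \<and> inj_on l Q \<and> l ` Q = F - {l d0} \<and>
    (\<forall>d\<in>D. d \<in> P \<or> a d \<in> P \<or> d \<in> Q \<or> a d \<in> Q) \<and>
    (\<forall>d\<in>P. a d \<notin> P \<and> d \<notin> Q \<and> a d \<notin> Q) \<and> (\<forall>d\<in>Q. a d \<notin> Q)"

lemma pmD:
  assumes "pm P Q"
  shows "P \<subseteq> D" "inj_on t P" "t d0 \<notin> t ` P" "Q \<subseteq> D" "inj_on l Q" "l d0 \<notin> l ` Q"
  using assms by (auto simp: pm_def)

text \<open>The orientation in which the whole matching is positive: an edge points to the vertex it
  is matched with, or has the face it is matched with on its left.\<close>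

definition ori where "ori P Q = {d\<in>D. a d \<in> P \<or> d \<in> Q}"

lemma pm_dual: "pm P Q \<Longrightarrow> cmap.pm D a l t d0 Q P"
  unfolding pm_def cmap.pm_def[OF dual] by (auto simp: subset_iff)

lemma pm_iff:
  assumes "pm P Q" "d \<in> D"
  shows "a d \<in> P \<Longrightarrow> d \<notin> P" "a d \<in> Q \<Longrightarrow> d \<notin> Q" "d \<in> P \<Longrightarrow> d \<notin> Q" "d \<in> P \<Longrightarrow> a d \<notin> Q" "a d \<in> P \<Longrightarrow> d \<notin> Q"
    "a d \<in> P \<Longrightarrow> a d \<notin> Q" "d \<in> P \<or> a d \<in> P \<or> d \<in> Q \<or> a d \<in> Q"
  using assms a_inv[OF assms(2)] unfolding pm_def by metis+

lemma ori_iff: "pm P Q \<Longrightarrow> d \<in> D \<Longrightarrow> d \<notin> ori P Q \<longleftrightarrow> d \<in> P \<or> a d \<in> Q"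
  using pm_iff[of P Q d] by (simp add: ori_def) blast

lemma ori_orient: "pm P Q \<Longrightarrow> orient D a (ori P Q)"
  unfolding orient_def using ori_iff[of P Q] by (auto simp: ori_def)

text \<open>As a dart of the dual map, \<open>d\<close> runs from its left face to its right face,
  opposite to the counterclockwise quarter turn; hence the complement.\<close>

lemma ori_dual: "pm P Q \<Longrightarrow> cmap.ori D a Q P = D - ori P Q"
  using ori_iff[of P Q] by (auto simp: cmap.ori_def[OF dual])

lemma pm_reach:
  assumes "pm P Q"
  shows "V \<subseteq> reachV P" "F \<subseteq> reachF Q"
  using tour[of P Q] assms by (auto simp: pm_def)

text \<open>Integrating along the dual tree \<open>Q\<close> gives an \<open>h\<close> that is right
  on its edges; the remainder is a circulation on the tree \<open>P\<close>, hence zero. The axioms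
  of \<open>cmap\<close> contain no Euler formula: planarity enters through the existence of the
  pair.\<close>

lemma circ_is_cob:
  assumes pm: "pm P Q" and z: "circ D a t z"
  obtains h where "\<And>d. d \<in> D \<Longrightarrow> z d = cob a l h d"
proof -
  note P = pmD(1-3)[OF pm] and Q = pmD(5,6)[OF pm]
  obtain h where h: "\<And>d. d \<in> Q \<Longrightarrow> l d \<in> reachF Q \<Longrightarrow> h (l d) - h (l (a d)) = - z d"
    using tree_potential[OF Q, where z="\<lambda>d. - z d" and a=a] by metis
  have hQ: "cob a l h d = z d" if "d \<in> Q" for d
  proof -
    have "l d \<in> reachF Q" using pm_reach(2)[OF pm] subsetD[OF pmD(4)[OF pm] that] by auto
    then show ?thesis using h[OF that] by (simp add: cob_def)
  qed
  have anti: "z (a d) = - z d" if "d \<in> D" for d using z that by (auto simp: circ_def)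
  have cobanti: "cob a l h (a d) = - cob a l h d" if "d \<in> D" for d using that by (auto simp: cob_def)
  have "z d - cob a l h d = 0" if "d \<in> D" for d
  proof (rule tree_flow_zero[OF P, where c="\<lambda>d. z d - cob a l h d"])
    show "(\<Sum>d\<in>{d\<in>D. t d = v}. z d - cob a l h d) = 0" for v
      using z circ_cob_l[of h] by (simp add: circ_def sum_subtractf)
    show "z d - cob a l h d = 0" if "d \<in> D" "d \<notin> P" "a d \<notin> P" for d
      using pm_iff(7)[OF pm that(1)] that hQ[of d] hQ[of "a d"] anti[of d] cobanti[of d] by auto
  qed (use that anti cobanti pm_reach(1)[OF pm] in auto)
  then show ?thesis using that by simp
qed

lemmas circ_is_cob_dual = cmap.circ_is_cob[OF dual]

section \<open>Unit flows along paths\<close>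

lemma sum_delta_t: "x \<in> D \<Longrightarrow> (\<Sum>e\<in>{e\<in>D. t e = u}. of_bool (e = x)) = (of_bool (u = t x) :: int)"
proof -
  assume "x \<in> D"
  have "(\<Sum>e\<in>{e\<in>D. t e = u}. of_bool (e = x)) = (\<Sum>e\<in>{e\<in>D. t e = u}. if e = x then 1 else 0 :: int)"
    by (rule sum.cong) auto
  then show ?thesis using fin \<open>x \<in> D\<close> by (auto simp: sum.delta)
qed

lemma a_eq: "e \<in> D \<Longrightarrow> d \<in> D \<Longrightarrow> a e = d \<longleftrightarrow> e = a d"
  by auto

text \<open>Each step of a walk from \<open>r\<close> to \<open>v\<close> adds 1 on its dart and
  subtracts 1 on the reverse. Darts of \<open>B\<close> point against the walk, so the unit flows
  from \<open>v\<close> to \<open>r\<close>.\<close>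

lemma path_flow:
  assumes B: "B \<subseteq> D" and v: "v \<in> reach a t r B"
  obtains y :: "'d \<Rightarrow> int" where "\<And>d. d \<in> D \<Longrightarrow> y (a d) = - y d"
    "\<And>d. d \<in> D \<Longrightarrow> d \<notin> B \<Longrightarrow> a d \<notin> B \<Longrightarrow> y d = 0"
    "\<And>d. (\<And>e. e \<in> B \<Longrightarrow> a e \<notin> B) \<Longrightarrow> d \<in> B \<Longrightarrow> y d \<ge> 0"
    "\<And>u. (\<Sum>d\<in>{d\<in>D. t d = u}. y d) = of_bool (u = v) - of_bool (u = r)"
proof -
  have "\<exists>y :: 'd \<Rightarrow> int. (\<forall>d\<in>D. y (a d) = - y d) \<and> (\<forall>d\<in>D. d \<notin> B \<longrightarrow> a d \<notin> B \<longrightarrow> y d = 0) \<and>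
    ((\<forall>e\<in>B. a e \<notin> B) \<longrightarrow> (\<forall>d\<in>B. y d \<ge> 0)) \<and>
    (\<forall>u. (\<Sum>d\<in>{d\<in>D. t d = u}. y d) = of_bool (u = v) - of_bool (u = r))"
    using v
  proof induction
    case root
    show ?case by (rule exI[of _ "\<lambda>_. 0"]) auto
  next
    case (step d)
    then obtain y :: "'d \<Rightarrow> int" where y: "\<forall>d\<in>D. y (a d) = - y d" "\<forall>d\<in>D. d \<notin> B \<longrightarrow> a d \<notin> B \<longrightarrow> y d = 0"
      "(\<forall>e\<in>B. a e \<notin> B) \<longrightarrow> (\<forall>d\<in>B. y d \<ge> 0)"
      "\<forall>u. (\<Sum>d\<in>{d\<in>D. t d = u}. y d) = of_bool (u = t (a d)) - of_bool (u = r)" by blast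
    have d: "d \<in> D" using step B by auto
    let ?y = "\<lambda>e. y e + of_bool (e = d) - of_bool (e = a d)"
    have "a e = d \<longleftrightarrow> e = a d" "a e = a d \<longleftrightarrow> e = d" if "e \<in> D" for e
      using that d by (metis a_inv)+
    then have 1: "\<forall>e\<in>D. ?y (a e) = - ?y e" using y(1) by auto
    have 2: "\<forall>e\<in>D. e \<notin> B \<longrightarrow> a e \<notin> B \<longrightarrow> ?y e = 0"
      using y(2) step(1) d by auto
    have 3: "(\<forall>e\<in>B. a e \<notin> B) \<longrightarrow> (\<forall>e\<in>B. ?y e \<ge> 0)"
      using y(3) step(1) by fastforce
    have 4: "(\<Sum>e\<in>{e\<in>D. t e = u}. ?y e) = of_bool (u = t d) - of_bool (u = r)" for u
      using y(4) sum_delta_t[OF d, of u] sum_delta_t[OF a_in[OF d], of u] by (simp add: sum.distrib sum_subtractf)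
    show ?case by (rule exI[of _ ?y]) (use 1 2 3 4 in blast)
  qed
  then show ?thesis using that by blast
qed

text \<open>The flow of the cycle part across the cut around the maximal level set A vanishes, while g drops by
  at least 1 on each edge of the cut; so all of these edges leave A in the first orientation.\<close>
lemma level_le_root:
  assumes pm: "pm P Q" and pm': "pm P' Q'"
    and x: "\<And>d. d \<in> D \<Longrightarrow> of_bool (d \<in> ori P' Q') - of_bool (d \<in> ori P Q) = cob a t g d + cob a l h d"
    and v: "v \<in> V"
  shows "g v \<le> g (t d0)"
proof (rule ccontr)
  assume less: "\<not> ?thesis"
  define m where "m = Max (g ` V)"
  have finV: "finite (g ` V)" using fin by auto
  have m: "g u \<le> m" if "u \<in> V" for u using that finV by (auto simp: m_def)
  have mV: "m \<in> g ` V" unfolding m_def by (rule Max_in) (use finV v in auto)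
  define A where "A = {u\<in>V. g u = m}"
  have q: "t d0 \<notin> A" using m[OF v] less by (auto simp: A_def)
  obtain w where w: "w \<in> A" using mV by (auto simp: A_def)
  let ?x = "\<lambda>d. of_bool (d \<in> ori P' Q') - of_bool (d \<in> ori P Q) :: int"
  let ?k = "cob a t (\<lambda>u. of_bool (u \<in> A))"
  let ?f = "\<lambda>d. (cob a t g d - ?x d) * ?k d"
  \<comment> \<open>If \<open>?k d\<close> is nonzero, exactly one end of \<open>d\<close> is in the
    top level; then \<open>cob a t g d\<close> has the sign of \<open>?k d\<close> and size at least
    1, while \<open>?x d\<close> has size at most 1.\<close>
  have cutpos: "?f d \<ge> 0" if "d \<in> D" for d
  proof -
    have "g (t d) \<le> m" "g (t (a d)) \<le> m" using m that by auto
    then show ?thesis using that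
      by (cases "g (t d) = m"; cases "g (t (a d)) = m") (auto simp: cob_def A_def of_bool_def)
  qed
  have "(\<Sum>d\<in>D. ?f d) = - (\<Sum>d\<in>D. cob a l h d * ?k d)"
    unfolding sum_negf[symmetric] by (rule sum.cong) (use x in auto)
  also have "\<dots> = 0" using circ_orth_cob[OF circ_cob_l] by simp
  finally have f0: "?f d = 0" if "d \<in> D" for d
    using cutpos that sum_nonneg_eq_0_iff[OF fin, of ?f] by blast
  \<comment> \<open>The arborescence enters \<open>A\<close> by an edge that the first orientation
    directs into \<open>A\<close>. There \<open>?x\<close> cannot be positive, so the summand
    is.\<close>
  have "w \<in> reachV P" using w pm_reach(1)[OF pm] by (auto simp: A_def)
  from reach_exit[OF this w q] obtain d where d: "d \<in> P" "t d \<in> A" "t (a d) \<notin> A" .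
  then have dD: "d \<in> D" using pm by (auto simp: pm_def)
  then have "a d \<in> ori P Q" using d by (auto simp: ori_def)
  then have "?x (a d) \<le> 0" by auto
  moreover have "cob a t g (a d) \<ge> 1" using d dD m[of "t (a d)"] by (auto simp: A_def cob_def)
  moreover have "?k (a d) = 1" using d dD by (auto simp: cob_def)
  ultimately show False using f0[OF a_in[OF dD]] by (simp only: mult_1_right)
qed

text \<open>Exchanging the two matchings negates \<open>g\<close> and \<open>h\<close> and turns the
  upper bound into a lower one.\<close>

lemma level_const:
  assumes pm: "pm P Q" and pm': "pm P' Q'"
    and x: "\<And>d. d \<in> D \<Longrightarrow> of_bool (d \<in> ori P' Q') - of_bool (d \<in> ori P Q) = cob a t g d + cob a l h d"
    and v: "v \<in> V"
  shows "g v = g (t d0)"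
proof -
  have "- g v \<le> - g (t d0)"
    by (rule level_le_root[OF pm' pm, where h="\<lambda>f. - h f", OF _ v]) (use x in \<open>auto simp: cob_def algebra_simps\<close>)
  then show ?thesis using level_le_root[OF pm pm' x v] by auto
qed

section \<open>Injectivity: matchings with equal classes are equal\<close>

lemmas level_const_dual = cmap.level_const[OF dual]

lemma pm_ori_subset:
  assumes pm: "pm P Q" and pm': "pm P' Q'" and eq: "ori P Q = ori P' Q'"
  shows "P \<subseteq> P'" "Q \<subseteq> Q'"
proof -
  have *: "P \<subseteq> D" "Q \<subseteq> D" "inj_on t P" "inj_on l Q" "t d0 \<notin> t ` P" "l d0 \<notin> l ` Q"
    "P' \<subseteq> D" "Q' \<subseteq> D" "inj_on t P'" "inj_on l Q'" "t d0 \<notin> t ` P'" "l d0 \<notin> l ` Q'"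
    using pmD[OF pm] pmD[OF pm'] by auto
  \<comment> \<open>A vertex reached in the common part is the root or has a common parent dart, and
    by injectivity no other dart of \<open>P\<close> or \<open>P'\<close> has this tail.\<close>
  have tP: "d \<in> P \<inter> P'" if "d \<in> P \<or> d \<in> P'" "t d \<in> reachV (P \<inter> P')" for d
    using reach_cases[OF that(2)] that(1) * by (metis IntD1 IntD2 IntI imageI inj_onD)
  have lQ: "d \<in> Q \<inter> Q'" if "d \<in> Q \<or> d \<in> Q'" "l d \<in> reachF (Q \<inter> Q')" for d
    using reach_cases[OF that(2)] that(1) * by (metis IntD1 IntD2 IntI imageI inj_onD)
  \<comment> \<open>If \<open>d\<close> itself is in none of the four sets, the orientation still
    tells \<open>a d\<close> in \<open>P\<close> from \<open>a d\<close> in \<open>Q\<close>, so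
    both matchings make the same choice.\<close>
  have dec: "d \<in> P \<inter> P' \<or> a d \<in> P \<inter> P' \<or> d \<in> Q \<inter> Q' \<or> a d \<in> Q \<inter> Q'"
    if d: "d \<in> D" "t d \<in> reachV (P \<inter> P')" "l d \<in> reachF (Q \<inter> Q')" for d
  proof -
    have "d \<in> ori P Q \<longleftrightarrow> d \<in> ori P' Q'" using eq by simp
    then have "a d \<in> P \<or> d \<in> Q \<longleftrightarrow> a d \<in> P' \<or> d \<in> Q'" using d by (auto simp: ori_def)
    then show ?thesis
      using tP[of d] lQ[of d] d pm_iff(7)[OF pm d(1)] pm_iff(7)[OF pm' d(1)] by blast
  qed
  have sub: "P \<inter> P' \<subseteq> D" "inj_on t (P \<inter> P')" "t d0 \<notin> t ` (P \<inter> P')"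
    "Q \<inter> Q' \<subseteq> D" "inj_on l (Q \<inter> Q')" "l d0 \<notin> l ` (Q \<inter> Q')"
    using * by (blast intro: inj_on_subset)+
  have full: "V \<subseteq> reachV (P \<inter> P')" "F \<subseteq> reachF (Q \<inter> Q')"
    by (rule tour[OF sub], rule dec, assumption+)+
  show "P \<subseteq> P'"
  proof
    fix d assume "d \<in> P"
    then show "d \<in> P'" using tP[of d] full(1) *(1) by auto
  qed
  show "Q \<subseteq> Q'"
  proof
    fix d assume "d \<in> Q"
    then show "d \<in> Q'" using lQ[of d] full(2) *(2) by auto
  qed
qed

lemma pm_injective:
  assumes pm: "pm P Q" and pm': "pm P' Q'"
    and x: "\<And>d. d \<in> D \<Longrightarrow> of_bool (d \<in> ori P' Q') - of_bool (d \<in> ori P Q) = cob a t g d + cob a l h d"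
  shows "P = P'" "Q = Q'"
proof -
  have g: "g v = g (t d0)" if "v \<in> V" for v
    by (rule level_const[OF pm pm' x that])
  \<comment> \<open>Duality complements both orientations and so negates their difference:
    \<open>- h\<close> plays the part of \<open>g\<close>.\<close>
  have h: "- h f = - h (l d0)" if "f \<in> F" for f
  proof (rule level_const_dual[OF pm_dual[OF pm] pm_dual[OF pm'], where h="\<lambda>v. - g v", OF _ that])
    fix d assume d: "d \<in> D"
    show "of_bool (d \<in> cmap.ori D a Q' P') - of_bool (d \<in> cmap.ori D a Q P) =
      cob a l (\<lambda>f. - h f) d + cob a t (\<lambda>v. - g v) d"
      unfolding ori_dual[OF pm] ori_dual[OF pm'] using x[OF d] d by (auto simp: cob_def of_bool_def split: if_splits)
  qed
  have "cob a t g d + cob a l h d = 0" if "d \<in> D" for d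
    unfolding cob_def using that g[of "t d"] g[of "t (a d)"] h[of "l d"] h[of "l (a d)"] by simp
  then have "d \<in> ori P' Q' \<longleftrightarrow> d \<in> ori P Q" if "d \<in> D" for d
    using x[OF that] that by (auto simp: of_bool_def split: if_splits)
  then have "ori P Q = ori P' Q'" by (auto simp: ori_def)
  then show "P = P'" "Q = Q'" using pm_ori_subset[OF pm pm'] pm_ori_subset[OF pm' pm] by auto
qed

end

section \<open>Orientations in a class\<close>

lemma card_Diff_less: "S \<subset> S' \<Longrightarrow> S' \<subseteq> A \<Longrightarrow> finite A \<Longrightarrow> card (A - S') < card (A - S)"
  by (rule psubset_card_mono) auto

context cmap
begin

section \<open>Directed cuts and directed cycles\<close>

lemmas circ_cob_t = cmap.circ_cob_l[OF dual]
lemmas circ_orth_cob_dual = cmap.circ_orth_cob[OF dual]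

text \<open>\<open>path_flow\<close> sends one unit from the head of \<open>d\<close> back to its
  tail; adding \<open>d\<close> closes a directed cycle.\<close>

lemma closed_flow:
  assumes B: "B \<subseteq> D" "\<And>e. e \<in> B \<Longrightarrow> a e \<notin> B" and d: "d \<in> B" and r: "t (a d) \<in> reach a t (t d) B"
  obtains z where "circ D a t z" "\<And>e. e \<in> B \<Longrightarrow> z e \<ge> 0" "z d \<ge> 1"
proof -
  have dD: "d \<in> D" using B d by auto
  obtain y :: "'d \<Rightarrow> int" where y: "\<And>d. d \<in> D \<Longrightarrow> y (a d) = - y d" "\<And>d. d \<in> B \<Longrightarrow> y d \<ge> 0"
    "\<And>u. (\<Sum>d\<in>{d\<in>D. t d = u}. y d) = of_bool (u = t (a d)) - of_bool (u = t d)"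
    by (rule path_flow[OF B(1) r]) (use B(2) in blast)
  let ?z = "\<lambda>e. y e + of_bool (e = d) - of_bool (e = a d)"
  have "circ D a t ?z"
    unfolding circ_def
  proof (intro conjI ballI allI)
    show "?z (a e) = - ?z e" if "e \<in> D" for e
      using y(1)[OF that] a_eq[OF that dD] a_eq[OF that a_in[OF dD]] dD by auto
    show "(\<Sum>e\<in>{e\<in>D. t e = u}. ?z e) = 0" for u
      using y(3)[of u] sum_delta_t[OF dD, of u] sum_delta_t[OF a_in[OF dD], of u]
      by (simp add: sum.distrib sum_subtractf)
  qed
  moreover have "?z e \<ge> 0" if "e \<in> B" for e using y(2)[OF that] B(2)[OF d] that by auto
  moreover have "?z d \<ge> 1" using y(2)[OF d] a_ne[OF dD] by auto
  ultimately show ?thesis using that by blast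
qed

lemmas closed_flow_dual = cmap.closed_flow[OF dual]

text \<open>Orientations are the functions u with u d + u (a d) = 1 and values in {0, 1}, i.e. those for which
  every summand is 1.\<close>
definition energy :: "('d \<Rightarrow> int) \<Rightarrow> nat" where "energy u = nat (\<Sum>d\<in>D. \<bar>2 * u d - 1\<bar>)"

lemma energy_less:
  assumes "\<And>d. d \<in> D \<Longrightarrow> \<bar>2 * u' d - 1\<bar> \<le> \<bar>2 * u d - 1\<bar>" "e \<in> D" "\<bar>2 * u' e - 1\<bar> < \<bar>2 * u e - 1\<bar>"
  shows "energy u' < energy u"
proof -
  have "(\<Sum>d\<in>D. \<bar>2 * u' d - 1\<bar>) < (\<Sum>d\<in>D. \<bar>2 * u d - 1\<bar>)"
    by (rule sum_strict_mono_ex1) (use fin assms in auto)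
  moreover have "0 \<le> (\<Sum>d\<in>D. \<bar>2 * u' d - 1\<bar>)" by (rule sum_nonneg) auto
  ultimately show ?thesis unfolding energy_def by linarith
qed

text \<open>Every dart entering the set reached from the head of \<open>d\<close> has
  \<open>u\<close> at least 1, and \<open>d\<close> enters it. Subtracting this cut enlarges no
  summand of the energy and shrinks that of \<open>d\<close>, where \<open>u\<close> is at least
  2.\<close>

lemma cut_step:
  assumes u: "\<And>d. d \<in> D \<Longrightarrow> u d + u (a d) = 1" and d: "d \<in> D" "u d \<ge> 2"
    and nr: "t d \<notin> reach a t (t (a d)) {e\<in>D. u e \<le> 0}"
  obtains g where "energy (\<lambda>e. u e + cob a t g e) < energy u"
proof -
  define R where "R = reach a t (t (a d)) {e\<in>D. u e \<le> 0}"
  define g where "g v = (- of_bool (v \<in> R) :: int)" for v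
  have enter: "u e \<ge> 1" if "e \<in> D" "t e \<notin> R" "t (a e) \<in> R" for e
  proof (rule ccontr)
    assume "\<not> ?thesis"
    then have "e \<in> {e\<in>D. u e \<le> 0}" using that by auto
    then have "t e \<in> R" using that(3) unfolding R_def by (rule reach.step)
    then show False using that by simp
  qed
  have le: "\<bar>2 * (u e + cob a t g e) - 1\<bar> \<le> \<bar>2 * u e - 1\<bar>" if "e \<in> D" for e
    using enter[of e] enter[of "a e"] u[OF that] that
    by (cases "t e \<in> R"; cases "t (a e) \<in> R") (auto simp: cob_def g_def)
  have "t (a d) \<in> R" unfolding R_def by (rule reach.root)
  moreover have "t d \<notin> R" using nr by (simp add: R_def)
  ultimately have "\<bar>2 * (u d + cob a t g d) - 1\<bar> < \<bar>2 * u d - 1\<bar>"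
    using d by (auto simp: cob_def g_def)
  then have "energy (\<lambda>e. u e + cob a t g e) < energy u"
    by (intro energy_less[OF le d(1)])
  then show ?thesis by (rule that)
qed

lemmas cut_step_dual = cmap.cut_step[OF dual]

text \<open>If \<open>d\<close> lay on a directed cycle both of the graph and of the dual, the two
  circulations would have a product that is nowhere positive and is negative at \<open>d\<close>.
  But the dual one is a vertex coboundary by \<open>circ_is_cob_dual\<close>, so the products sum to
  0.\<close>

lemma no_cut_and_cycle:
  assumes pm: "pm P Q" and U: "orient D a U" and d: "d \<in> U"
    and r: "t d \<in> reach a t (t (a d)) (D - U)" and r': "l (a d) \<in> reach a l (l d) U"
  shows False
proof -
  have UD: "U \<subseteq> D" and Ua: "\<And>e. e \<in> D \<Longrightarrow> a e \<in> U \<longleftrightarrow> e \<notin> U" using U by (auto simp: orient_def)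
  have dD: "d \<in> D" using UD d by auto
  obtain z where z: "circ D a t z" "\<And>e. e \<in> D - U \<Longrightarrow> z e \<ge> 0" "z (a d) \<ge> 1"
    by (rule closed_flow[of "D - U" "a d"]) (use Ua dD d r in auto)
  obtain z' where z': "circ D a l z'" "\<And>e. e \<in> U \<Longrightarrow> z' e \<ge> 0" "z' d \<ge> 1"
    by (rule closed_flow_dual[OF UD _ d r']) (use Ua UD in auto)
  obtain g where g: "\<And>e. e \<in> D \<Longrightarrow> z' e = cob a t g e"
    using circ_is_cob_dual[OF pm_dual[OF pm] z'(1)] by blast
  have za: "z (a e) = - z e" "z' (a e) = - z' e" if "e \<in> D" for e
    using z(1) z'(1) that by (auto simp: circ_def)
  have "(\<Sum>e\<in>D. - (z e * z' e)) = - (\<Sum>e\<in>D. z e * cob a t g e)"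
    unfolding sum_negf[symmetric] by (rule sum.cong) (use g in auto)
  also have "\<dots> = 0" using circ_orth_cob[OF z(1)] by simp
  finally have sum0: "(\<Sum>e\<in>D. - (z e * z' e)) = 0" .
  have nn: "- (z e * z' e) \<ge> 0" if e: "e \<in> D" for e
  proof (cases "e \<in> U")
    case True
    then have "z e \<le> 0" "z' e \<ge> 0" using z(2)[of "a e"] z'(2)[of e] za[OF e] Ua[OF e] e by auto
    then show ?thesis by (simp add: mult_nonpos_nonneg)
  next
    case False
    then have "z e \<ge> 0" "z' e \<le> 0" using z(2)[of e] z'(2)[of "a e"] za[OF e] Ua[OF e] e by auto
    then show ?thesis by (simp add: mult_nonneg_nonpos)
  qed
  have "- (z d * z' d) = 0" using sum_nonneg_eq_0_iff[OF fin nn] sum0 dD by auto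
  then show False using z(3) z'(3) za(1)[OF dD] by auto
qed

text \<open>By no_cut_and_cycle an edge with u > 1 lies on a directed cut of the graph or of its dual; subtracting
  that cut decreases the energy.\<close>
lemma round_to_orientation:
  assumes pm: "pm P Q" and u: "\<And>d. d \<in> D \<Longrightarrow> u d + u (a d) = (1::int)"
  shows "\<exists>U g h. orient D a U \<and> (\<forall>d\<in>D. of_bool (d \<in> U) - u d = cob a t g d + cob a l h d)"
  using u
proof (induction "energy u" arbitrary: u rule: less_induct)
  case less
  note u = less.prems
  show ?case
  proof (cases "\<forall>d\<in>D. u d \<in> {0, 1}")
    case True
    let ?U = "{d\<in>D. u d = 1}"
    have "orient D a ?U" using u True by (fastforce simp: orient_def)
    moreover have "of_bool (d \<in> ?U) - u d = cob a t (\<lambda>_. 0) d + cob a l (\<lambda>_. 0) d" if "d \<in> D" for d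
      using True that by (auto simp: cob_def)
    ultimately show ?thesis by blast
  next
    case False
    then obtain e where e: "e \<in> D" "u e \<noteq> 0" "u e \<noteq> 1" by auto
    obtain d where d: "d \<in> D" "u d \<ge> 2"
    proof (cases "u e \<ge> 2")
      case True
      then show ?thesis using that e(1) by blast
    next
      case False
      then have "u (a e) \<ge> 2" using u[OF e(1)] e by auto
      then show ?thesis using that a_in[OF e(1)] by blast
    qed
    let ?U = "{e\<in>D. u e \<ge> 1}"
    have U: "orient D a ?U" using u by (fastforce simp: orient_def)
    have DU: "D - ?U = {e\<in>D. u e \<le> 0}" by auto
    have "\<not> (t d \<in> reach a t (t (a d)) (D - ?U) \<and> l (a d) \<in> reach a l (l d) ?U)"
      using no_cut_and_cycle[OF pm U, of d] d by auto
    then consider "t d \<notin> reach a t (t (a d)) {e\<in>D. u e \<le> 0}" | "l (a d) \<notin> reach a l (l d) ?U"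
      using DU by auto
    then obtain g h where less': "energy (\<lambda>e. u e + (cob a t g e + cob a l h e)) < energy u"
    proof cases
      case 1
      obtain g where "energy (\<lambda>e. u e + cob a t g e) < energy u"
        using cut_step[OF u d 1] by blast
      then show ?thesis using that[of g "\<lambda>_. 0"] by (simp add: cob_def)
    next
      case 2
      \<comment> \<open>Duality complements orientations, so the cut step is applied to
        \<open>1 - u\<close> at the dart \<open>a d\<close>; the energy is unchanged by this
        substitution.\<close>
      let ?w = "\<lambda>e. 1 - u e"
      have en: "energy (\<lambda>e. 1 - w e) = energy w" for w
        unfolding energy_def by (rule arg_cong[where f=nat], rule sum.cong) auto
      have w: "?w (a d) \<ge> 2" "\<And>e. e \<in> D \<Longrightarrow> ?w e + ?w (a e) = 1" using d u by fastforce+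
      have "l (a d) \<notin> reach a l (l (a (a d))) {e\<in>D. ?w e \<le> 0}" using 2 d by simp
      from cut_step_dual[where u="?w", OF w(2) a_in[OF d(1)] w(1) this]
      obtain h where "energy (\<lambda>e. ?w e + cob a l h e) < energy ?w"
        by blast
      then have "energy (\<lambda>e. 1 - (?w e + cob a l h e)) < energy u" unfolding en by simp
      moreover have "(\<lambda>e. 1 - (?w e + cob a l h e)) = (\<lambda>e. u e + (cob a t (\<lambda>_. 0) e + cob a l (\<lambda>f. - h f) e))"
        by (auto simp: cob_def)
      ultimately show ?thesis using that by metis
    qed
    let ?u = "\<lambda>e. u e + (cob a t g e + cob a l h e)"
    have "?u e + ?u (a e) = 1" if "e \<in> D" for e using u[OF that] that by (simp add: cob_def)
    from less.hyps[OF less' this] obtain U g' h' where U: "orient D a U"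
      and *: "\<forall>d\<in>D. of_bool (d \<in> U) - ?u d = cob a t g' d + cob a l h' d" by blast
    have "of_bool (d \<in> U) - u d = cob a t (\<lambda>v. g v + g' v) d + cob a l (\<lambda>f. h f + h' f) d" if "d \<in> D" for d
      using *[rule_format, OF that] by (simp add: cob_def)
    then show ?thesis using U by blast
  qed
qed

text \<open>All edges between the reached set \<open>R\<close> and its complement are directed into
  \<open>R\<close>. Reversing them keeps the walks inside \<open>R\<close>, and by connectedness
  there is such an edge, which now leads to a new vertex.\<close>

lemma cut_reverse:
  assumes U: "orient D a U" and nr: "\<not> V \<subseteq> reachV (D - U)"
  obtains U' g where "orient D a U'" "\<And>d. d \<in> D \<Longrightarrow> of_bool (d \<in> U') - of_bool (d \<in> U) = cob a t g d"
    "reachV (D - U) \<subset> reachV (D - U')"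
proof -
  define R where "R = reachV (D - U)"
  have Ua: "a e \<in> U \<longleftrightarrow> e \<notin> U" if "e \<in> D" for e using U that by (auto simp: orient_def)
  have out: "e \<notin> U" if "e \<in> D" "t e \<in> R" "t (a e) \<notin> R" for e
  proof
    assume "e \<in> U"
    then have "a e \<in> D - U" using that Ua by auto
    then have "t (a e) \<in> R" unfolding R_def by (rule reach.step) (use that in \<open>simp add: R_def\<close>)
    then show False using that by simp
  qed
  define U' where "U' = {d\<in>D. (t d \<in> R \<and> t (a d) \<notin> R) \<or> ((t d \<in> R \<longleftrightarrow> t (a d) \<in> R) \<and> d \<in> U)}"
  have or': "orient D a U'" unfolding orient_def U'_def using Ua by auto
  have g: "of_bool (d \<in> U') - of_bool (d \<in> U) = cob a t (\<lambda>v. of_bool (v \<notin> R)) d" if "d \<in> D" for d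
    using that out[of d] out[of "a d"] Ua[OF that]
    by (cases "t d \<in> R"; cases "t (a d) \<in> R") (auto simp: cob_def U'_def)
  have sub: "v \<in> reachV (D - U')" if "v \<in> R" for v
    using that unfolding R_def
  proof induction
    case (step d)
    then have "t (a d) \<in> R" "t d \<in> R" unfolding R_def by (auto intro: reach.step)
    then have "d \<in> D - U'" using step(1) by (auto simp: U'_def)
    then show ?case using step.IH by (rule reach.step)
  qed (rule reach.root)
  have "\<exists>d\<in>D. t d \<in> R \<and> t (a d) \<notin> R"
  proof (rule ccontr)
    assume c: "\<not> ?thesis"
    have "{d\<in>D. t d \<in> R} = D"
    proof (rule connected)
      have "d0 \<in> {d\<in>D. t d \<in> R}" by (auto simp: R_def reach.root)
      then show "{d\<in>D. t d \<in> R} \<noteq> {}" by blast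
    qed (use c t_s in auto)
    then show False using nr by (auto simp: R_def)
  qed
  then obtain d where d: "d \<in> D" "t d \<in> R" "t (a d) \<notin> R" by auto
  have "a d \<in> D - U'" using d by (auto simp: U'_def)
  then have "t (a d) \<in> reachV (D - U')" by (rule reach.step) (use d sub in auto)
  then have "reachV (D - U) \<subset> reachV (D - U')" using sub d unfolding R_def by blast
  then show ?thesis using that[OF or' g] by blast
qed

lemmas cut_reverse_dual = cmap.cut_reverse[OF dual]

text \<open>The boundary of the face set \<open>R\<close> reached in \<open>U\<close> is directed by
  \<open>U\<close>, so its darts could change in one sense only. Orthogonality to the coboundary of
  \<open>g\<close> then excludes any change there, and no step of \<open>U'\<close> leaves
  \<open>R\<close>.\<close>

lemma reachF_cut_invariant:
  assumes U: "orient D a U" and U': "orient D a U'"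
    and g: "\<And>d. d \<in> D \<Longrightarrow> of_bool (d \<in> U') - of_bool (d \<in> U) = cob a t g d"
  shows "reachF U' \<subseteq> reachF U"
proof -
  define R where "R = reachF U"
  let ?k = "cob a l (\<lambda>f. of_bool (f \<in> R))"
  have Ua: "a e \<in> U \<longleftrightarrow> e \<notin> U" "a e \<in> U' \<longleftrightarrow> e \<notin> U'" if "e \<in> D" for e
    using U U' that by (auto simp: orient_def)
  have out: "e \<in> U" if "e \<in> D" "l e \<in> R" "l (a e) \<notin> R" for e
  proof (rule ccontr)
    assume "e \<notin> U"
    then have "a e \<in> U" using that Ua by auto
    then have "l (a e) \<in> R" unfolding R_def by (rule reach.step) (use that in \<open>simp add: R_def\<close>)
    then show False using that by simp
  qed
  have nn: "cob a t g d * ?k d \<ge> 0" if "d \<in> D" for d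
    using out[of d] out[of "a d"] Ua[OF that] that unfolding g[OF that, symmetric]
    by (cases "l d \<in> R"; cases "l (a d) \<in> R") (auto simp: cob_def)
  have "(\<Sum>d\<in>D. cob a t g d * ?k d) = 0" by (rule circ_orth_cob_dual[OF circ_cob_t])
  then have z: "cob a t g d * ?k d = 0" if "d \<in> D" for d
    using sum_nonneg_eq_0_iff[OF fin nn] that by auto
  have "v \<in> R" if "v \<in> reachF U'" for v
    using that
  proof induction
    case (step d)
    have dD: "d \<in> D" using step U' by (auto simp: orient_def)
    show ?case
    proof (rule ccontr)
      assume "l d \<notin> R"
      moreover have "l (a d) \<in> R" by fact
      ultimately have "d \<notin> U" "?k d = 1" using out[of "a d"] dD Ua[OF dD] by (auto simp: cob_def)
      then show False using z[OF dD] step(1) unfolding g[OF dD, symmetric] by auto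
    qed
  qed (simp add: R_def reach.root)
  then show ?thesis by (auto simp: R_def)
qed

lemmas reachV_cut_invariant = cmap.reachF_cut_invariant[OF dual]

lemma orient_compl: "orient D a U \<Longrightarrow> orient D a (D - U)"
  by (auto simp: orient_def)

lemma orient_compl_compl: "orient D a U \<Longrightarrow> D - (D - U) = U"
  by (auto simp: orient_def)

text \<open>Induction on the number of unreached vertices and faces: reversing a directed cut gains
  a vertex and, by \<open>reachF_cut_invariant\<close>, loses no face; dually for cycles.\<close>

lemma reach_all:
  assumes U: "orient D a U"
  shows "\<exists>U' g h. orient D a U' \<and> (\<forall>d\<in>D. of_bool (d \<in> U') - of_bool (d \<in> U) = cob a t g d + cob a l h d)
    \<and> V \<subseteq> reachV (D - U') \<and> F \<subseteq> reachF U'"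
  using U
proof (induction "card (V - reachV (D - U)) + card (F - reachF U)" arbitrary: U rule: less_induct)
  case less
  note U = less.prems
  show ?case
  proof (cases "V \<subseteq> reachV (D - U) \<and> F \<subseteq> reachF U")
    case True
    then show ?thesis using U
      by (intro exI[of _ U] exI[of _ "\<lambda>_. 0"]) (auto simp: cob_def)
  next
    case False
    have reachV_sub: "reachV (D - W) \<subseteq> V" for W
    proof
      fix v assume "v \<in> reachV (D - W)"
      from reach_cases[OF this] show "v \<in> V" by auto
    qed
    have reachF_sub: "reachF W \<subseteq> F" if "orient D a W" for W
    proof
      fix v assume "v \<in> reachF W"
      from reach_cases[OF this] show "v \<in> F" using that by (auto simp: orient_def)
    qed
    obtain W g h where W: "orient D a W"
      "\<And>d. d \<in> D \<Longrightarrow> of_bool (d \<in> W) - of_bool (d \<in> U) = cob a t g d + cob a l h d"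
      "card (V - reachV (D - W)) + card (F - reachF W) < card (V - reachV (D - U)) + card (F - reachF U)"
    proof (cases "V \<subseteq> reachV (D - U)")
      case False
      obtain W g where W: "orient D a W" "\<And>d. d \<in> D \<Longrightarrow> of_bool (d \<in> W) - of_bool (d \<in> U) = cob a t g d"
        "reachV (D - U) \<subset> reachV (D - W)" using cut_reverse[OF U False] by blast
      \<comment> \<open>Invariance is used for the way back from \<open>W\<close> to
        \<open>U\<close>, whose coboundary is that of \<open>- g\<close>.\<close>
      have "reachF U \<subseteq> reachF W"
        by (rule reachF_cut_invariant[OF W(1) U, of "\<lambda>v. - g v"]) (use W(2) in \<open>auto simp: cob_def algebra_simps\<close>)
      then have "card (F - reachF W) \<le> card (F - reachF U)" by (intro card_mono Diff_mono) (use fin in simp_all)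
      moreover have "card (V - reachV (D - W)) < card (V - reachV (D - U))"
        by (rule card_Diff_less[OF W(3) reachV_sub]) (use fin in simp)
      ultimately show ?thesis using that[of W g "\<lambda>_. 0"] W by (simp add: cob_def)
    next
      case True
      then have nr: "\<not> F \<subseteq> reachF (D - (D - U))" using False orient_compl_compl[OF U] by simp
      obtain W h where W: "orient D a W" "\<And>d. d \<in> D \<Longrightarrow> of_bool (d \<in> W) - of_bool (d \<in> D - U) = cob a l h d"
        "reachF (D - (D - U)) \<subset> reachF (D - W)"
        using cut_reverse_dual[OF orient_compl[OF U] nr] by blast
      have "reachV (D - U) \<subseteq> reachV W"
        by (rule reachV_cut_invariant[OF W(1) orient_compl[OF U], of "\<lambda>v. - h v"])
          (use W(2) in \<open>auto simp: cob_def algebra_simps\<close>)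
      then have "card (V - reachV W) \<le> card (V - reachV (D - U))" by (intro card_mono Diff_mono) (use fin in simp_all)
      moreover have "card (F - reachF (D - W)) < card (F - reachF U)"
        using card_Diff_less[OF W(3) reachF_sub[OF orient_compl[OF W(1)]]] fin orient_compl_compl[OF U] by simp
      moreover have "of_bool (d \<in> D - W) - of_bool (d \<in> U) = cob a t (\<lambda>_. 0) d + cob a l (\<lambda>f. - h f) d" if "d \<in> D" for d
        using W(2)[OF that] that by (auto simp: cob_def of_bool_def split: if_splits)
      ultimately show ?thesis using that[of "D - W" "\<lambda>_. 0" "\<lambda>f. - h f"] orient_compl[OF W(1)] orient_compl_compl[OF W(1)] by simp
    qed
    from less.hyps[OF W(3,1)] obtain U' g' h' where U': "orient D a U'"
      "\<forall>d\<in>D. of_bool (d \<in> U') - of_bool (d \<in> W) = cob a t g' d + cob a l h' d"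
      "V \<subseteq> reachV (D - U')" "F \<subseteq> reachF U'" by (elim exE conjE)
    have eq: "of_bool (d \<in> U') - of_bool (d \<in> U) = cob a t (\<lambda>v. g v + g' v) d + cob a l (\<lambda>f. h f + h' f) d" if "d \<in> D" for d
      using U'(2)[rule_format, OF that] W(2)[OF that] by (simp add: cob_def)
    show ?thesis
      by (rule exI[of _ U'], rule exI[of _ "\<lambda>v. g v + g' v"], rule exI[of _ "\<lambda>f. h f + h' f"],
        intro conjI ballI U'(1,3,4), rule eq)
  qed
qed

end

section \<open>Orientations with full reachability come from matchings\<close>

context cmap
begin

text \<open>The reachability conditions survive because a dart is only added to P when its left face already
  belongs to the arborescence Q, and dually.\<close>
definition partial_pm where
  "partial_pm U P Q \<longleftrightarrow> P \<subseteq> D - U \<and> Q \<subseteq> U \<and> inj_on t P \<and> t d0 \<notin> t ` P \<and> inj_on l Q \<and> l d0 \<notin> l ` Q \<and>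
    (\<forall>d\<in>P. a d \<notin> Q) \<and>
    V \<subseteq> reachV {d\<in>D - U. a d \<notin> Q} \<and> F \<subseteq> reachF {d\<in>U. a d \<notin> P} \<and> t ` P \<subseteq> reachV P \<and> l ` Q \<subseteq> reachF Q"

lemma partial_pm_dual:
  assumes U: "orient D a U"
  shows "cmap.partial_pm D a l t d0 (D - U) Q P \<longleftrightarrow> partial_pm U P Q"
proof -
  have UD: "D - (D - U) = U" "U \<subseteq> D" using U by (auto simp: orient_def)
  have *: "(\<forall>d\<in>P. a d \<notin> Q) \<longleftrightarrow> (\<forall>d\<in>Q. a d \<notin> P)" if "P \<subseteq> D - U" "Q \<subseteq> U"
    using that UD(2) by (metis DiffD1 a_inv subsetD)
  show ?thesis
  proof (cases "P \<subseteq> D - U \<and> Q \<subseteq> U")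
    case True
    then show ?thesis
      unfolding partial_pm_def cmap.partial_pm_def[OF dual] UD(1) using * by satx
  next
    case False
    then show ?thesis
      unfolding partial_pm_def cmap.partial_pm_def[OF dual] UD(1) by satx
  qed
qed

text \<open>The vertex \<open>t (a d)\<close> becomes a child of \<open>t d\<close>. It is new,
  since a cycle formed by \<open>d\<close> and edges of \<open>P\<close> would separate faces, while
  all faces are still reached across other edges.\<close>

lemma partial_pm_extend:
  assumes pm: "pm P0 Q0" and U: "orient D a U" and st: "partial_pm U P Q"
    and d: "d \<in> U" "t d \<in> reachV P" "l d \<in> reachF Q" "a d \<notin> P" "d \<notin> Q"
  shows "partial_pm U (insert (a d) P) Q"
proof -
  have UD: "U \<subseteq> D" and Ua: "\<And>e. e \<in> D \<Longrightarrow> a e \<in> U \<longleftrightarrow> e \<notin> U" using U by (auto simp: orient_def)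
  have P: "P \<subseteq> D - U" "inj_on t P" "t d0 \<notin> t ` P" "t ` P \<subseteq> reachV P"
    and Q: "Q \<subseteq> U" "inj_on l Q" "l d0 \<notin> l ` Q" "l ` Q \<subseteq> reachF Q" and PQ: "\<And>e. e \<in> P \<Longrightarrow> a e \<notin> Q"
    and rV: "V \<subseteq> reachV {d\<in>D - U. a d \<notin> Q}" and rF: "F \<subseteq> reachF {d\<in>U. a d \<notin> P}"
    using st by (auto simp: partial_pm_def)
  have dD: "d \<in> D" and adU: "a d \<notin> U" and dP: "d \<notin> P" using d UD Ua P by auto
  let ?P = "insert (a d) P" and ?B = "{e\<in>U. a e \<notin> insert (a d) P}"
  have QB: "Q \<subseteq> ?B"
  proof
    fix e assume e: "e \<in> Q"
    then have eD: "e \<in> D" using Q UD by auto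
    have "a e \<notin> P" using PQ[of "a e"] e eD by auto
    moreover have "a e \<noteq> a d" using e d dD eD by (metis a_inv)
    ultimately show "e \<in> ?B" using e Q by auto
  qed
  \<comment> \<open>The only step lost is the one across \<open>d\<close> into \<open>l d\<close>,
    and this face is also reached along \<open>Q\<close>, which lies inside
    \<open>?B\<close>.\<close>
  have "reachF {e\<in>U. a e \<notin> P} \<subseteq> reachF ?B"
  proof (rule reach_mono_on)
    fix e assume e: "e \<in> {e\<in>U. a e \<notin> P}" "l (a e) \<in> reachF ?B"
    show "l e \<in> reachF ?B"
    proof (cases "e = d")
      case True
      have "reachF Q \<subseteq> reachF ?B" by (rule reach_mono_on) (use QB in \<open>auto intro: reach.step\<close>)
      then show ?thesis using d True by auto
    next
      case False
      then have "a e \<noteq> a d" using e dD UD by (metis (mono_tags) a_inv mem_Collect_eq subsetD)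
      then have "e \<in> ?B" using e by auto
      then show ?thesis using e(2) by (rule reach.step)
    qed
  qed
  then have rB: "F \<subseteq> reachF ?B" using rF by auto
  have new: "t (a d) \<notin> reachV P"
  proof
    assume r: "t (a d) \<in> reachV P"
    have PD: "P \<subseteq> D" using P by auto
    obtain y :: "'d \<Rightarrow> int" where y: "\<And>d. d \<in> D \<Longrightarrow> y (a d) = - y d"
      "\<And>d. d \<in> D \<Longrightarrow> d \<notin> P \<Longrightarrow> a d \<notin> P \<Longrightarrow> y d = 0"
      "\<And>u. (\<Sum>d\<in>{d\<in>D. t d = u}. y d) = of_bool (u = t d) - of_bool (u = t d0)"
      by (rule path_flow[OF PD d(2)]) blast
    obtain y' :: "'d \<Rightarrow> int" where y': "\<And>d. d \<in> D \<Longrightarrow> y' (a d) = - y' d"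
      "\<And>d. d \<in> D \<Longrightarrow> d \<notin> P \<Longrightarrow> a d \<notin> P \<Longrightarrow> y' d = 0"
      "\<And>u. (\<Sum>d\<in>{d\<in>D. t d = u}. y' d) = of_bool (u = t (a d)) - of_bool (u = t d0)"
      by (rule path_flow[OF PD r]) blast
    let ?z = "\<lambda>e. y' e - y e + of_bool (e = d) - of_bool (e = a d)"
    have "circ D a t ?z"
      unfolding circ_def
    proof (intro conjI ballI allI)
      show "?z (a e) = - ?z e" if "e \<in> D" for e
        using y(1)[OF that] y'(1)[OF that] a_eq[OF that dD] a_eq[OF that a_in[OF dD]] dD by auto
      show "(\<Sum>e\<in>{e\<in>D. t e = u}. ?z e) = 0" for u
        using y(3)[of u] y'(3)[of u] sum_delta_t[OF dD, of u] sum_delta_t[OF a_in[OF dD], of u]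
        by (simp add: sum.distrib sum_subtractf)
    qed
    then obtain h where h: "\<And>e. e \<in> D \<Longrightarrow> ?z e = cob a l h e" using circ_is_cob[OF pm] by blast
    \<comment> \<open>Steps of \<open>?B\<close> avoid the edges that carry \<open>?z\<close>, so
      \<open>h\<close> has its outer value on all faces, against \<open>?z d = 1\<close>.\<close>
    have hc: "h f = h (l d0)" if "f \<in> reachF ?B" for f
      using that
    proof induction
      case (step e)
      then have e: "e \<in> D" "e \<notin> P" "a e \<notin> P" "e \<noteq> d" "e \<noteq> a d" using UD P adU by auto
      then have "?z e = 0" using y(2) y'(2) by simp
      then show ?case using h[OF e(1)] step.IH by (simp add: cob_def)
    qed simp
    have "l d \<in> reachF ?B" "l (a d) \<in> reachF ?B" using rB dD by auto
    then have "?z d = 0" using hc[of "l d"] hc[of "l (a d)"] unfolding h[OF dD] cob_def by simp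
    then show False using y(2)[OF dD dP d(4)] y'(2)[OF dD dP d(4)] a_ne[OF dD] by simp
  qed
  have sub: "reachV P \<subseteq> reachV ?P" by (rule reach_mono_on) (auto intro: reach.step)
  have "a d \<in> ?P" by simp
  then have "t (a d) \<in> reachV ?P" by (rule reach.step) (use d sub dD in auto)
  moreover have "t (a d) \<notin> t ` P" using new P by auto
  moreover have "t (a d) \<noteq> t d0" using new by (metis reach.root)
  ultimately have tP': "inj_on t ?P" "t d0 \<notin> t ` ?P" "t ` ?P \<subseteq> reachV ?P"
    using P sub by (auto simp: inj_on_insert)
  have "\<forall>e\<in>?P. a e \<notin> Q" using PQ d dD by auto
  then show ?thesis
    unfolding partial_pm_def using P(1) Q tP' rV rB dD adU by simp
qed

lemmas partial_pm_extend_dual = cmap.partial_pm_extend[OF dual]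

text \<open>In a pair of largest total size no dart at a corner of both root components is
  undecided: its reverse could be added to \<open>P\<close> or to \<open>Q\<close>, according to its
  direction. So \<open>tour\<close> applies.\<close>

lemma positive_pm_exists:
  assumes pm: "pm P0 Q0" and U: "orient D a U" and V: "V \<subseteq> reachV (D - U)" and F: "F \<subseteq> reachF U"
  obtains P Q where "pm P Q" "ori P Q = U"
proof -
  have UD: "U \<subseteq> D" and Ua: "\<And>e. e \<in> D \<Longrightarrow> a e \<in> U \<longleftrightarrow> e \<notin> U" using U by (auto simp: orient_def)
  let ?S = "{(P, Q). partial_pm U P Q}"
  have "?S \<subseteq> Pow D \<times> Pow D" using UD by (auto simp: partial_pm_def)
  then have finS: "finite ?S" using fin by (meson finite_Pow_iff finite_SigmaI finite_subset)
  have "{d\<in>D - U. a d \<notin> {}} = D - U" "{d\<in>U. a d \<notin> {}} = U" by auto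
  then have "({}, {}) \<in> ?S" using V F unfolding partial_pm_def by simp
  then have ne: "?S \<noteq> {}" by blast
  define f where "f = (\<lambda>(P :: 'd set, Q :: 'd set). card P + card Q)"
  have "Max (f ` ?S) \<in> f ` ?S" by (rule Max_in) (use finS ne in auto)
  then obtain x where x: "x \<in> ?S" "f x = Max (f ` ?S)" by auto
  obtain P Q where PQ: "x = (P, Q)" by force
  have st: "partial_pm U P Q" using x PQ by auto
  have max: "card P' + card Q' \<le> card P + card Q" if "partial_pm U P' Q'" for P' Q'
  proof -
    have "f (P', Q') \<le> Max (f ` ?S)" by (rule Max_ge) (use finS that in auto)
    then show ?thesis using x(2) PQ by (simp add: f_def)
  qed
  have P: "P \<subseteq> D" "P \<subseteq> D - U" "inj_on t P" "t d0 \<notin> t ` P"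
    and Q: "Q \<subseteq> D" "Q \<subseteq> U" "inj_on l Q" "l d0 \<notin> l ` Q" and disj: "\<And>e. e \<in> P \<Longrightarrow> a e \<notin> Q"
    using st UD by (auto simp: partial_pm_def)
  have finPQ: "finite P" "finite Q" using P Q fin finite_subset by auto
  have dec: "d \<in> P \<or> a d \<in> P \<or> d \<in> Q \<or> a d \<in> Q"
    if d: "d \<in> D" "t d \<in> reachV P" "l d \<in> reachF Q" for d
  proof (rule ccontr)
    assume n: "\<not> ?thesis"
    show False
    proof (cases "d \<in> U")
      case True
      have "partial_pm U (insert (a d) P) Q"
        by (rule partial_pm_extend[OF pm U st True]) (use d n in auto)
      from max[OF this] show False using n finPQ by simp
    next
      case False
      have "cmap.partial_pm D a l t d0 (D - U) (insert (a d) Q) P"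
        by (rule partial_pm_extend_dual[OF pm_dual[OF pm] orient_compl[OF U]])
          (use st partial_pm_dual[OF U] False d n in auto)
      then have "partial_pm U P (insert (a d) Q)" using partial_pm_dual[OF U] by blast
      from max[OF this] show False using n finPQ by simp
    qed
  qed
  have full: "V \<subseteq> reachV P" "F \<subseteq> reachF Q"
    by (rule tour[OF P(1,3,4) Q(1,3,4)], rule dec, assumption+)+
  have all: "d \<in> P \<or> a d \<in> P \<or> d \<in> Q \<or> a d \<in> Q" if "d \<in> D" for d
    by (rule dec) (use that full in auto)
  have "V - {t d0} \<subseteq> t ` P"
  proof
    fix v assume v: "v \<in> V - {t d0}"
    then have "v \<in> reachV P" using full by auto
    from reach_cases[OF this] show "v \<in> t ` P" using v by auto
  qed
  then have tP: "t ` P = V - {t d0}" using P(1,4) by blast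
  have "F - {l d0} \<subseteq> l ` Q"
  proof
    fix v assume v: "v \<in> F - {l d0}"
    then have "v \<in> reachF Q" using full by auto
    from reach_cases[OF this] show "v \<in> l ` Q" using v by auto
  qed
  then have lQ: "l ` Q = F - {l d0}" using Q(1,4) by blast
  have "a d \<notin> P \<and> d \<notin> Q \<and> a d \<notin> Q" if "d \<in> P" for d
    using that subsetD[OF P(2) that] P(2) Q(2) Ua[of d] disj[of d] by auto
  moreover have "a d \<notin> Q" if "d \<in> Q" for d
    using subsetD[OF Q(1) that] subsetD[OF Q(2) that] Q(2) Ua[of d] by auto
  ultimately have excl: "\<forall>d\<in>P. a d \<notin> P \<and> d \<notin> Q \<and> a d \<notin> Q" "\<forall>d\<in>Q. a d \<notin> Q" by blast+
  have "pm P Q" unfolding pm_def using P(1,3) Q(1,3) tP lQ all excl by simp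
  moreover have "ori P Q = U"
  proof
    show "ori P Q \<subseteq> U" using P(2) Q(2) Ua by (auto simp: ori_def)
    show "U \<subseteq> ori P Q"
    proof
      fix d assume d: "d \<in> U"
      then have "d \<in> D" using UD by auto
      then show "d \<in> ori P Q" using all[of d] d P(2) Q(2) Ua[of d] by (auto simp: ori_def)
    qed
  qed
  ultimately show ?thesis by (rule that)
qed

lemma pm_surjective:
  assumes pm: "pm P0 Q0" and u: "\<And>d. d \<in> D \<Longrightarrow> u d + u (a d) = (1::int)"
  obtains P Q g h where "pm P Q" "\<And>d. d \<in> D \<Longrightarrow> of_bool (d \<in> ori P Q) - u d = cob a t g d + cob a l h d"
proof -
  obtain U g h where U: "orient D a U" "\<forall>d\<in>D. of_bool (d \<in> U) - u d = cob a t g d + cob a l h d"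
    using round_to_orientation[where u=u, OF pm u] by metis
  obtain U' g' h' where U': "orient D a U'"
    "\<forall>d\<in>D. of_bool (d \<in> U') - of_bool (d \<in> U) = cob a t g' d + cob a l h' d"
    "V \<subseteq> reachV (D - U')" "F \<subseteq> reachF U'" using reach_all[OF U(1)] by metis
  obtain P Q where PQ: "pm P Q" "ori P Q = U'" by (rule positive_pm_exists[OF pm U'(1,3,4)])
  have "of_bool (d \<in> ori P Q) - u d = cob a t (\<lambda>v. g v + g' v) d + cob a l (\<lambda>f. h f + h' f) d" if "d \<in> D" for d
    using U(2)[rule_format, OF that] U'(2)[rule_format, OF that] PQ(2) by (simp add: cob_def)
  then show ?thesis by (rule that[OF PQ(1)])
qed

end

section \<open>Spanning trees\<close>

lemma reach_mono: "B \<subseteq> C \<Longrightarrow> reach a t r B \<subseteq> reach a t r C"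
  by (rule reach_mono_on) (auto intro: reach.step)

lemma reach_trans:
  assumes "w \<in> reach a t v B" "v \<in> reach a t r B"
  shows "w \<in> reach a t r B"
  using assms(1) by induction (auto intro: assms(2) reach.step)

context cmap
begin

lemma reach_sym:
  assumes B: "B \<subseteq> D" "\<And>d. d \<in> B \<Longrightarrow> a d \<in> B" and v: "v \<in> reach a t r B"
  shows "r \<in> reach a t v B"
  using v
proof induction
  case (step d)
  have "a d \<in> B" using step B by auto
  then have "t (a d) \<in> reach a t (t d) B"
    by (rule reach.step) (use step(1) B(1) reach.root[of "t d" a t B] in auto)
  then show ?case using step.IH reach_trans by metis
qed (rule reach.root)

text \<open>Before its first use of the edge, a walk stays in \<open>B - {d, a d}\<close> and has
  come to one end of that edge.\<close>

lemma reach_remove_edge: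
  assumes "d \<in> D" "v \<in> reach a t r B"
  shows "v \<in> reach a t r (B - {d, a d}) \<or> t d \<in> reach a t r (B - {d, a d}) \<or> t (a d) \<in> reach a t r (B - {d, a d})"
  using assms(2)
proof induction
  case (step e)
  show ?case
  proof (cases "e = d \<or> e = a d")
    case True
    then show ?thesis using step.IH assms(1) by auto
  next
    case False
    then have "e \<in> B - {d, a d}" using step by auto
    then show ?thesis using step.IH reach.step[of e "B - {d, a d}" t a r] by auto
  qed
qed (simp add: reach.root)

lemma arborescence_exists:
  assumes B: "B \<subseteq> D"
  obtains Q where "Q \<subseteq> B" "inj_on t Q" "t d0 \<notin> t ` Q" "reachV B \<subseteq> reachV Q"
proof -
  let ?S = "{Q. Q \<subseteq> B \<and> inj_on t Q \<and> t d0 \<notin> t ` Q \<and> t ` Q \<subseteq> reachV Q}"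
  have "?S \<subseteq> Pow D" using B by auto
  then have finS: "finite ?S" using fin by (meson finite_Pow_iff finite_subset)
  have "{} \<in> ?S" by simp
  then have "Max (card ` ?S) \<in> card ` ?S" using finS by (intro Max_in) blast+
  then obtain Q where Q: "Q \<in> ?S" "card Q = Max (card ` ?S)" by auto
  then have Q': "Q \<subseteq> B" "inj_on t Q" "t d0 \<notin> t ` Q" "t ` Q \<subseteq> reachV Q" by auto
  have finQ: "finite Q" using Q'(1) B fin finite_subset by metis
  have "reachV B \<subseteq> reachV Q"
  proof (rule reach_mono_on, rule ccontr)
    fix d assume d: "d \<in> B" "t (a d) \<in> reachV Q" "t d \<notin> reachV Q"
    have sub: "reachV Q \<subseteq> reachV (insert d Q)" by (rule reach_mono) auto
    have "d \<in> insert d Q" by simp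
    then have "t d \<in> reachV (insert d Q)" by (rule reach.step) (use d sub in auto)
    moreover have "t d \<notin> t ` Q" "t d \<noteq> t d0" using d Q' by (auto intro: reach.root)
    ultimately have "insert d Q \<in> ?S" using Q' sub d by (auto simp: inj_on_insert)
    then have "card (insert d Q) \<le> card Q" unfolding Q(2) using finS by (intro Max_ge) auto
    moreover have "d \<notin> Q" using d Q' by auto
    ultimately show False using finQ by simp
  qed
  then show ?thesis using that Q' by blast
qed

lemmas arborescence_exists_dual = cmap.arborescence_exists[OF dual]

text \<open>Otherwise the tails of \<open>d\<close> and \<open>a d\<close> would be each other's
  parents, and no step from the root could enter this pair.\<close>

lemma arborescence_antisym:
  assumes Q: "Q \<subseteq> D" "inj_on t Q" "t d0 \<notin> t ` Q" "V \<subseteq> reachV Q" and d: "d \<in> Q"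
  shows "a d \<notin> Q"
proof
  assume ad: "a d \<in> Q"
  have dD: "d \<in> D" using Q d by auto
  have "t d \<in> reachV Q" using Q(4) dD by auto
  then obtain e where e: "e \<in> Q" "t e \<in> {t d, t (a d)}" "t (a e) \<notin> {t d, t (a d)}"
    by (rule reach_exit[where A="{t d, t (a d)}"]) (use Q(3) d ad in auto)
  then have "e = d \<or> e = a d" using inj_onD[OF Q(2)] d ad by blast
  then show False using e dD by auto
qed

lemmas arborescence_antisym_dual = cmap.arborescence_antisym[OF dual]

lemma card_double:
  assumes "Q \<subseteq> D" "\<And>d. d \<in> Q \<Longrightarrow> a d \<notin> Q"
  shows "card (Q \<union> a ` Q) = 2 * card Q"
proof -
  have "inj_on a Q" using a_bij assms(1) by (auto simp: bij_betw_def intro: inj_on_subset)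
  then have "card (a ` Q) = card Q" by (rule card_image)
  moreover have "finite Q" using assms(1) fin finite_subset by metis
  moreover have "Q \<inter> a ` Q = {}" using assms(2) by auto
  ultimately show ?thesis by (simp add: card_Un_disjoint)
qed

section \<open>Spanning trees as sets of darts\<close>

definition span_tree where
  "span_tree T \<longleftrightarrow> T \<subseteq> D \<and> (\<forall>d\<in>T. a d \<in> T) \<and> V \<subseteq> reachV T \<and>
    (\<forall>d\<in>T. t (a d) \<notin> reach a t (t d) (T - {d, a d}))"

text \<open>The darts from a vertex to its parent: deleting the edge cuts the tail off from the
  root. They become the primal half of the Temperley matching.\<close>

definition parent_darts where "parent_darts T = {d\<in>T. t d \<notin> reachV (T - {d, a d})}"

text \<open>When a tree edge is deleted, some end stays with the root because \<open>T\<close> is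
  connected, and not both, because the ends would then still be joined.\<close>

lemma parent_darts_iff:
  assumes T: "span_tree T" and d: "d \<in> T"
  shows "a d \<in> parent_darts T \<longleftrightarrow> d \<notin> parent_darts T"
proof -
  have TD: "T \<subseteq> D" "\<And>d. d \<in> T \<Longrightarrow> a d \<in> T" and r: "V \<subseteq> reachV T" using T by (auto simp: span_tree_def)
  have dD: "d \<in> D" using TD d by auto
  let ?R = "reachV (T - {d, a d})"
  have "\<not> (t d \<in> ?R \<and> t (a d) \<in> ?R)"
  proof
    assume *: "t d \<in> ?R \<and> t (a d) \<in> ?R"
    have "t d0 \<in> reach a t (t d) (T - {d, a d})"
      by (rule reach_sym) (use * TD dD a_eq in auto)
    then have "t (a d) \<in> reach a t (t d) (T - {d, a d})" using * reach_trans by metis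
    then show False using T d by (auto simp: span_tree_def)
  qed
  moreover have "t d \<in> ?R \<or> t (a d) \<in> ?R"
    using reach_remove_edge[OF dD, of "t d" "t d0" T] r dD by auto
  moreover have "{a d, a (a d)} = {d, a d}" using dD by auto
  ultimately show ?thesis using d TD by (auto simp: parent_darts_def)
qed

lemma parent_darts_tree:
  assumes T: "span_tree T"
  shows "parent_darts T \<subseteq> D" "inj_on t (parent_darts T)" "t d0 \<notin> t ` parent_darts T" "V \<subseteq> reachV (parent_darts T)"
proof -
  have TD: "T \<subseteq> D" "\<And>d. d \<in> T \<Longrightarrow> a d \<in> T" and r: "V \<subseteq> reachV T" using T by (auto simp: span_tree_def)
  show sub: "parent_darts T \<subseteq> D" using TD by (auto simp: parent_darts_def)
  show q: "t d0 \<notin> t ` parent_darts T"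
  proof
    assume "t d0 \<in> t ` parent_darts T"
    then obtain d where "t d = t d0" "t d \<notin> reachV (T - {d, a d})" by (auto simp: parent_darts_def)
    then show False by (metis reach.root)
  qed
  show inj: "inj_on t (parent_darts T)"
  proof (rule inj_onI, rule ccontr)
    fix d e assume d: "d \<in> parent_darts T" and e: "e \<in> parent_darts T" and eq: "t d = t e" and ne: "d \<noteq> e"
    have dT: "d \<in> T" "e \<in> T" and dD: "d \<in> D" "e \<in> D" using d e TD by (auto simp: parent_darts_def)
    have "e \<noteq> a d" using parent_darts_iff[OF T dT(1)] d e by auto
    then have e': "e \<notin> {d, a d}" "a e \<notin> {d, a d}" "d \<notin> {e, a e}" "a d \<notin> {e, a e}"
      using ne dD by (auto simp: a_eq)
    have nd: "t d \<notin> reachV (T - {d, a d})" and nde: "t e \<notin> reachV (T - {e, a e})" using d e by (auto simp: parent_darts_def)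
    have "a d \<notin> parent_darts T" using parent_darts_iff[OF T dT(1)] d by auto
    moreover have "{a d, a (a d)} = {d, a d}" using dD by auto
    ultimately have pd: "t (a d) \<in> reachV (T - {d, a d})" using dT TD by (auto simp: parent_darts_def)
    \<comment> \<open>A walk to the head of \<open>d\<close> either avoids \<open>e\<close> or first
      meets an end of \<open>e\<close>; each case reaches the common tail without \<open>d\<close>
      or without \<open>e\<close>.\<close>
    let ?W = "T - {d, a d} - {e, a e}"
    have W: "reachV ?W \<subseteq> reachV (T - {d, a d})" "reachV ?W \<subseteq> reachV (T - {e, a e})"
      by (rule reach_mono; blast)+
    consider "t (a d) \<in> reachV ?W" | "t e \<in> reachV ?W" | "t (a e) \<in> reachV ?W"
      using reach_remove_edge[OF dD(2) pd] by blast
    then show False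
    proof cases
      case 1
      have "d \<in> T - {e, a e}" using dT e' by auto
      then have "t d \<in> reachV (T - {e, a e})" by (rule reach.step) (use 1 W in auto)
      then show False using nde eq by simp
    next
      case 2
      then show False using W nd eq by auto
    next
      case 3
      have "e \<in> T - {d, a d}" using dT e' by auto
      then have "t e \<in> reachV (T - {d, a d})" by (rule reach.step) (use 3 W in auto)
      then show False using nd eq by simp
    qed
  qed
  have "reachV T \<subseteq> reachV (parent_darts T)"
  proof (rule reach_mono_on)
    fix d assume d: "d \<in> T" "t (a d) \<in> reachV (parent_darts T)"
    show "t d \<in> reachV (parent_darts T)"
    proof (cases "d \<in> parent_darts T")
      case True
      then show ?thesis using d(2) by (rule reach.step)
    next
      case False
      then have "a d \<in> parent_darts T" using parent_darts_iff[OF T d(1)] by simp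
      from reach_parent[OF this inj q d(2)] show ?thesis using d TD by auto
    qed
  qed
  then show "V \<subseteq> reachV (parent_darts T)" using r by auto
qed

text \<open>The boundary of the set R of reached faces is a circulation supported on the tree, hence zero.\<close>
lemma tree_cotree_connected:
  assumes T: "span_tree T"
  shows "F \<subseteq> reachF (D - T)"
proof -
  have TD: "T \<subseteq> D" "\<And>d. d \<in> T \<Longrightarrow> a d \<in> T" using T by (auto simp: span_tree_def)
  define R where "R = reachF (D - T)"
  let ?c = "cob a l (\<lambda>f. of_bool (f \<in> R))"
  have stepR: "l d \<in> R" if "d \<in> D" "d \<notin> T" "l (a d) \<in> R" for d
  proof -
    have "d \<in> D - T" using that by auto
    then show ?thesis unfolding R_def by (rule reach.step) (use that in \<open>simp add: R_def\<close>)
  qed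
  have aT: "a d \<notin> T" if "d \<in> D" "d \<notin> T" for d using TD(2)[of "a d"] that by auto
  have c0: "?c d = 0" if "d \<in> D" for d
  proof (rule tree_flow_zero[OF parent_darts_tree(1-3)[OF T]])
    show "?c d = 0" if "d \<in> D" "d \<notin> parent_darts T" "a d \<notin> parent_darts T" for d
    proof -
      have "d \<notin> T" using parent_darts_iff[OF T, of d] that by auto
      then show ?thesis using stepR[of d] stepR[of "a d"] aT[of d] that by (auto simp: cob_def)
    qed
    show "t d \<in> reachV (parent_darts T)" using parent_darts_tree(4)[OF T] that by auto
  qed (use that circ_cob_l in \<open>auto simp: circ_def\<close>)
  have "{d\<in>D. l d \<in> R} = D"
  proof (rule cmap.connected[OF dual])
    have "d0 \<in> {d\<in>D. l d \<in> R}" by (auto simp: R_def reach.root)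
    then show "{d\<in>D. l d \<in> R} \<noteq> {}" by blast
    show "a d \<in> {d\<in>D. l d \<in> R}" if "d \<in> {d\<in>D. l d \<in> R}" for d
      using c0[of d] that by (auto simp: cob_def of_bool_def split: if_splits)
  qed (auto simp: l_as)
  then show ?thesis by (auto simp: R_def)
qed

text \<open>\<open>Q\<close> is a spanning arborescence of the dual that uses cotree edges only. By
  Euler's formula its edges and those of \<open>T\<close> exhaust all edges, which is the covering
  condition.\<close>

lemma tree_pm:
  assumes T: "span_tree T" and euler: "2 * card V + 2 * card F = card D + 4"
  obtains Q where "pm (parent_darts T) Q" "Q \<union> a ` Q = D - T"
proof -
  have TD: "T \<subseteq> D" "\<And>d. d \<in> T \<Longrightarrow> a d \<in> T" using T by (auto simp: span_tree_def)
  have aT: "a d \<notin> T" if "d \<in> D" "d \<notin> T" for d using TD(2)[of "a d"] that by auto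
  obtain Q where Q: "Q \<subseteq> D - T" "inj_on l Q" "l d0 \<notin> l ` Q" "reachF (D - T) \<subseteq> reachF Q"
    by (rule arborescence_exists_dual[of "D - T"]) blast+
  have QD: "Q \<subseteq> D" and rF: "F \<subseteq> reachF Q" using Q tree_cotree_connected[OF T] by auto
  have Qa: "a d \<notin> Q" if "d \<in> Q" for d by (rule arborescence_antisym_dual[OF QD Q(2,3) rF that])
  note P = parent_darts_tree[OF T]
  have Pa: "a d \<notin> parent_darts T" if "d \<in> parent_darts T" for d using parent_darts_iff[OF T, of d] that by (auto simp: parent_darts_def)
  have "V - {t d0} \<subseteq> t ` parent_darts T"
  proof
    fix v assume v: "v \<in> V - {t d0}"
    then have "v \<in> reachV (parent_darts T)" using P(4) by auto
    from reach_cases[OF this] show "v \<in> t ` parent_darts T" using v by auto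
  qed
  then have tP: "t ` parent_darts T = V - {t d0}" using P(1,3) by blast
  have "F - {l d0} \<subseteq> l ` Q"
  proof
    fix v assume v: "v \<in> F - {l d0}"
    then have "v \<in> reachF Q" using rF by auto
    from reach_cases[OF this] show "v \<in> l ` Q" using v by auto
  qed
  then have lQ: "l ` Q = F - {l d0}" using QD Q(3) by blast
  have cP: "card (parent_darts T) = card V - 1"
    using card_image[OF P(2)] tP fin by simp
  have cQ: "card Q = card F - 1"
    using card_image[OF Q(2)] lQ fin by simp
  have TP: "T = parent_darts T \<union> a ` parent_darts T"
  proof
    show "parent_darts T \<union> a ` parent_darts T \<subseteq> T" using TD by (auto simp: parent_darts_def)
    show "T \<subseteq> parent_darts T \<union> a ` parent_darts T"
    proof
      fix d assume d: "d \<in> T"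
      show "d \<in> parent_darts T \<union> a ` parent_darts T"
      proof (cases "d \<in> parent_darts T")
        case False
        then have "a d \<in> parent_darts T" using parent_darts_iff[OF T d] by simp
        moreover have "d = a (a d)" using d TD by auto
        ultimately show ?thesis by blast
      qed simp
    qed
  qed
  have cT: "card T = 2 * card (parent_darts T)" using card_double[OF P(1) Pa] TP by simp
  have "card V \<ge> 1" "card F \<ge> 1" using fin d0_in by (metis One_nat_def Suc_leI card_gt_0_iff empty_iff finite_imageI image_is_empty)+
  moreover have "card (Q \<union> a ` Q) = 2 * card Q" by (rule card_double[OF QD Qa])
  moreover have "card (D - T) = card D - card T"
    by (rule card_Diff_subset[OF finite_subset[OF TD(1) fin] TD(1)])
  ultimately have "card (Q \<union> a ` Q) = card (D - T)" using cT cP cQ euler by linarith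
  moreover have "Q \<union> a ` Q \<subseteq> D - T" using Q(1) aT by auto
  ultimately have all: "Q \<union> a ` Q = D - T" using fin by (intro card_subset_eq) auto
  have cover: "d \<in> parent_darts T \<or> a d \<in> parent_darts T \<or> d \<in> Q \<or> a d \<in> Q" if "d \<in> D" for d
  proof (cases "d \<in> T")
    case True
    then show ?thesis using parent_darts_iff[OF T] by blast
  next
    case False
    then have "d \<in> Q \<union> a ` Q" using all that by auto
    then show ?thesis using QD by auto
  qed
  have "parent_darts T \<subseteq> T" by (auto simp: parent_darts_def)
  then have excl: "a d \<notin> parent_darts T \<and> d \<notin> Q \<and> a d \<notin> Q" if "d \<in> parent_darts T" for d
    using that Pa Q(1) TD(2) by blast
  have "pm (parent_darts T) Q" unfolding pm_def using P(1,2) QD Q(2) tP lQ cover excl Qa by simp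
  then show ?thesis using that all by blast
qed

definition cycle_darts where
  "cycle_darts T d = {d, a d} \<union> {e\<in>T. t d \<notin> reach a t (t (a d)) (T - {e, a e})}"

text \<open>The fundamental cycle of d is the coboundary of a face function, which is constant off the cycle
  and jumps across d.\<close>
lemma cotree_orientation:
  assumes T: "span_tree T" and pm: "pm (parent_darts T) Q" and QT: "Q \<union> a ` Q = D - T" and d: "d \<in> Q"
  shows "l (a d) \<in> reachF (D - cycle_darts T d)" "l d \<notin> reachF (D - cycle_darts T d)"
proof -
  have TD: "T \<subseteq> D" "\<And>d. d \<in> T \<Longrightarrow> a d \<in> T" and rT: "V \<subseteq> reachV T" using T by (auto simp: span_tree_def)
  have dD: "d \<in> D" and QD: "Q \<subseteq> D" using pmD(4)[OF pm] d by auto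
  have "a d \<in> Q \<union> a ` Q" using d by simp
  then have dT: "d \<notin> T" "a d \<notin> T" using d QT by blast+
  \<comment> \<open>A walk in \<open>Q\<close> that uses \<open>d\<close> has come to
    \<open>l (a d)\<close> before, so this face is reached without \<open>d\<close>.\<close>
  have "f \<in> reachF (Q - {d}) \<or> l (a d) \<in> reachF (Q - {d})" if "f \<in> reachF Q" for f
    using that
  proof induction
    case (step e)
    show ?case
    proof (cases "e = d")
      case True
      then show ?thesis using step.IH by auto
    next
      case False
      then have "e \<in> Q - {d}" using step by auto
      then show ?thesis using step.IH reach.step[of e "Q - {d}" l a] by auto
    qed
  qed (simp add: reach.root)
  moreover have "l (a d) \<in> reachF Q" using pm_reach(2)[OF pm] dD by auto
  ultimately have "l (a d) \<in> reachF (Q - {d})" by blast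
  moreover have "Q - {d} \<subseteq> D - cycle_darts T d"
  proof
    fix e assume e: "e \<in> Q - {d}"
    then have "e \<notin> T" "e \<in> D" using QT by blast+
    moreover have "a d \<notin> Q" using pm_iff(2)[OF pm dD] d by auto
    ultimately show "e \<in> D - cycle_darts T d" using e by (auto simp: cycle_darts_def)
  qed
  ultimately show out: "l (a d) \<in> reachF (D - cycle_darts T d)" using reach_mono[of "Q - {d}" "D - cycle_darts T d" a l] by auto
  have r: "t d \<in> reach a t (t (a d)) T"
  proof -
    have "t d0 \<in> reach a t (t (a d)) T" by (rule reach_sym) (use TD rT dD in auto)
    then show ?thesis using reach_trans[of "t d" a t "t d0" T "t (a d)"] rT dD by auto
  qed
  obtain y :: "'d \<Rightarrow> int" where y: "\<And>d. d \<in> D \<Longrightarrow> y (a d) = - y d"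
    "\<And>d. d \<in> D \<Longrightarrow> d \<notin> T \<Longrightarrow> a d \<notin> T \<Longrightarrow> y d = 0"
    "\<And>u. (\<Sum>d\<in>{d\<in>D. t d = u}. y d) = of_bool (u = t d) - of_bool (u = t (a d))"
    by (rule path_flow[OF TD(1) r]) blast
  have aT: "a e \<notin> T" if "e \<in> D" "e \<notin> T" for e using TD(2)[of "a e"] that by auto
  have y0: "y e = 0" if e: "e \<in> D" "e \<notin> cycle_darts T d" for e
  proof (cases "e \<in> T")
    case False
    then show ?thesis using y(2)[OF e(1)] aT[OF e(1)] by auto
  next
    case True
    have W: "T - {e, a e} \<subseteq> D" using TD by auto
    have "t d \<in> reach a t (t (a d)) (T - {e, a e})" using True e by (auto simp: cycle_darts_def)
    then obtain y' :: "'d \<Rightarrow> int" where y': "\<And>d. d \<in> D \<Longrightarrow> y' (a d) = - y' d"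
      "\<And>d. d \<in> D \<Longrightarrow> d \<notin> T - {e, a e} \<Longrightarrow> a d \<notin> T - {e, a e} \<Longrightarrow> y' d = 0"
      "\<And>u. (\<Sum>d\<in>{d\<in>D. t d = u}. y' d) = of_bool (u = t d) - of_bool (u = t (a d))"
      by (rule path_flow[OF W]) blast
    \<comment> \<open>Both are flows on the tree with the same source and sink, so their difference
      is a circulation on the tree and vanishes; and \<open>y'\<close> avoids
      \<open>e\<close>.\<close>
    have "y e - y' e = 0"
    proof (rule tree_flow_zero[OF parent_darts_tree(1-3)[OF T], where c="\<lambda>e. y e - y' e"])
      show "(\<Sum>d\<in>{d\<in>D. t d = v}. y d - y' d) = 0" for v
        unfolding sum_subtractf y(3) y'(3) by simp
      show "y f - y' f = 0" if "f \<in> D" "f \<notin> parent_darts T" "a f \<notin> parent_darts T" for f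
      proof -
        have "f \<notin> T" using parent_darts_iff[OF T, of f] that by auto
        then show ?thesis using y(2)[of f] y'(2)[of f] aT[of f] that by auto
      qed
      show "t e \<in> reachV (parent_darts T)" using parent_darts_tree(4)[OF T] e by auto
    qed (use y(1) y'(1) e in auto)
    moreover have "y' e = 0" using y'(2)[OF e(1)] by auto
    ultimately show ?thesis by simp
  qed
  let ?z = "\<lambda>e. y e - of_bool (e = d) + of_bool (e = a d)"
  have "circ D a t ?z"
    unfolding circ_def
  proof (intro conjI ballI allI)
    show "?z (a e) = - ?z e" if "e \<in> D" for e
      using y(1)[OF that] a_eq[OF that dD] a_eq[OF that a_in[OF dD]] dD by auto
    show "(\<Sum>e\<in>{e\<in>D. t e = u}. ?z e) = 0" for u
      using y(3)[of u] sum_delta_t[OF dD, of u] sum_delta_t[OF a_in[OF dD], of u]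
      by (simp add: sum.distrib sum_subtractf)
  qed
  then obtain h where h: "\<And>e. e \<in> D \<Longrightarrow> ?z e = cob a l h e" using circ_is_cob[OF pm] by blast
  have hc: "h f = h (l d0)" if "f \<in> reachF (D - cycle_darts T d)" for f
    using that
  proof induction
    case (step e)
    then have "?z e = 0" using y0[of e] by (auto simp: cycle_darts_def)
    then show ?case using h[of e] step by (simp add: cob_def)
  qed simp
  show "l d \<notin> reachF (D - cycle_darts T d)"
  proof
    assume "l d \<in> reachF (D - cycle_darts T d)"
    then have "?z d = 0" using hc[OF out] hc[of "l d"] unfolding h[OF dD] cob_def by simp
    then show False using y(2)[OF dD dT] a_ne[OF dD] by simp
  qed
qed

lemma cycle_darts_sym:
  assumes T: "span_tree T" and d: "d \<in> D"
  shows "cycle_darts T (a d) = cycle_darts T d"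
proof -
  have TD: "T \<subseteq> D" "\<And>d. d \<in> T \<Longrightarrow> a d \<in> T" using T by (auto simp: span_tree_def)
  have "t (a d) \<in> reach a t (t d) (T - {e, a e}) \<longleftrightarrow> t d \<in> reach a t (t (a d)) (T - {e, a e})" if "e \<in> T" for e
  proof -
    have "T - {e, a e} \<subseteq> D" "\<And>x. x \<in> T - {e, a e} \<Longrightarrow> a x \<in> T - {e, a e}" using TD that by (auto dest: arg_cong[where f=a] simp: subset_iff)
    then show ?thesis using reach_sym[of "T - {e, a e}"] by metis
  qed
  then show ?thesis using d by (auto simp: cycle_darts_def)
qed

end

section \<open>Plane graphs\<close>

lemma orbit_refl: "x \<in> orbit f x"
  unfolding orbit_def by (rule CollectI, rule exI[of _ 0]) simp

lemma orbit_step: "y \<in> orbit f x \<Longrightarrow> f y \<in> orbit f x"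
  unfolding orbit_def
proof clarify
  fix n show "\<exists>m. f ((f ^^ n) x) = (f ^^ m) x \<and> True" by (rule exI[of _ "Suc n"]) simp
qed

lemma orbit_least:
  assumes "x \<in> X" "\<And>y. y \<in> X \<Longrightarrow> f y \<in> X"
  shows "orbit f x \<subseteq> X"
proof -
  have "(f ^^ n) x \<in> X" for n by (induction n) (use assms in auto)
  then show ?thesis by (auto simp: orbit_def)
qed

text \<open>On a finite set the injection \<open>f\<close> permutes the forward orbit of
  \<open>f x\<close>, which therefore contains \<open>x\<close>, the only preimage of
  \<open>f x\<close> in \<open>D\<close>.\<close>

lemma orbit_apply:
  assumes f: "bij_betw f D D" and fin: "finite D" and x: "x \<in> D"
  shows "orbit f (f x) = orbit f x"
proof
  show "orbit f (f x) \<subseteq> orbit f x"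
    by (rule orbit_least) (auto intro: orbit_step orbit_refl)
  have fD: "f y \<in> D" if "y \<in> D" for y using f that by (auto simp: bij_betw_def)
  have sub: "orbit f (f x) \<subseteq> D" by (rule orbit_least) (use x fD in auto)
  have inj: "inj_on f D" using f by (simp add: bij_betw_def)
  have "f ` orbit f (f x) = orbit f (f x)"
    by (rule endo_inj_surj) (use sub fin inj in \<open>auto intro: orbit_step finite_subset inj_on_subset\<close>)
  then obtain y where "y \<in> orbit f (f x)" "f x = f y" using orbit_refl[of "f x" f] by (metis imageE)
  then have "x \<in> orbit f (f x)" using inj_onD[OF inj, of x y] x sub by auto
  then show "orbit f x \<subseteq> orbit f (f x)" by (rule orbit_least) (rule orbit_step)
qed

lemma orbit_eq_closed:
  assumes "orbit f y = orbit f x" "x \<in> X" "\<And>z. z \<in> X \<Longrightarrow> f z \<in> X"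
  shows "y \<in> X"
proof -
  have "orbit f x \<subseteq> X" by (rule orbit_least[OF assms(2,3)])
  then show ?thesis using orbit_refl[of y f] assms(1) by auto
qed

lemma plane_map_cmap:
  assumes "plane_map G" "d0 \<in> darts G"
  shows "cmap (darts G) (alp G) (sig G) (vert_of G) (face_of G) d0"
proof -
  have fin: "finite (darts G)" and a: "\<And>d. d \<in> darts G \<Longrightarrow> alp G d \<in> darts G \<and> alp G d \<noteq> d \<and> alp G (alp G d) = d"
    and s: "bij_betw (sig G) (darts G) (darts G)"
    and c: "\<And>d d'. d \<in> darts G \<Longrightarrow> d' \<in> darts G \<Longrightarrow> (d, d') \<in> {(x, y). x \<in> darts G \<and> (y = alp G x \<or> y = sig G x)}\<^sup>*"
    using assms(1) by (auto simp: plane_map_def)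
  have abij: "bij_betw (alp G) (darts G) (darts G)"
    by (rule bij_betw_byWitness[where f'="alp G"]) (use a in auto)
  have as: "bij_betw (alp G \<circ> sig G) (darts G) (darts G)" using bij_betw_trans[OF s abij] .
  show ?thesis
  proof
    show "vert_of G (sig G d) = vert_of G d" if "d \<in> darts G" for d
      unfolding vert_of_def by (rule orbit_apply[OF s fin that])
    show "face_of G (alp G (sig G d)) = face_of G d" if "d \<in> darts G" for d
      unfolding face_of_def using orbit_apply[OF as fin that] by simp
    show "d' \<in> X" if "\<And>d. d \<in> X \<Longrightarrow> sig G d \<in> X" "d \<in> X" "vert_of G d' = vert_of G d" for X d d'
      using orbit_eq_closed[of "sig G" d' d X] that by (simp add: vert_of_def)
    show "d' \<in> X" if "\<And>d. d \<in> X \<Longrightarrow> alp G (sig G d) \<in> X" "d \<in> X" "face_of G d' = face_of G d" for X d d'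
      using orbit_eq_closed[of "alp G \<circ> sig G" d' d X] that by (simp add: face_of_def)
    show "X = darts G" if X: "X \<subseteq> darts G" "X \<noteq> {}" "\<And>d. d \<in> X \<Longrightarrow> alp G d \<in> X" "\<And>d. d \<in> X \<Longrightarrow> sig G d \<in> X" for X
    proof
      obtain d where d: "d \<in> X" using X by auto
      show "darts G \<subseteq> X"
      proof
        fix e assume "e \<in> darts G"
        then have "(d, e) \<in> {(x, y). x \<in> darts G \<and> (y = alp G x \<or> y = sig G x)}\<^sup>*" using c d X by auto
        then show "e \<in> X" by induction (use d X in auto)
      qed
    qed (rule X)
  qed (use a fin s assms in auto)
qed

lemma plane_map_euler:
  assumes "plane_map G"
  shows "2 * card (verts G) + 2 * card (faces G) = card (darts G) + 4"
proof -
  have fin: "finite (darts G)" and a: "\<And>d. d \<in> darts G \<Longrightarrow> alp G d \<in> darts G \<and> alp G d \<noteq> d \<and> alp G (alp G d) = d"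
    and e: "int (card (verts G)) - int (card (edges G)) + int (card (faces G)) = 2"
    using assms by (auto simp: plane_map_def)
  have un: "\<Union> (edges G) = darts G" using a by (auto simp: edges_def edge_of_def)
  have "2 * card (edges G) = card (\<Union> (edges G))"
  proof (rule card_partition)
    show "card c = 2" if c: "c \<in> edges G" for c
    proof -
      obtain d where d: "d \<in> darts G" "c = {d, alp G d}" using c unfolding edges_def edge_of_def by blast
      moreover have "d \<noteq> alp G d" using a[OF d(1)] by metis
      ultimately show ?thesis by simp
    qed
    show "c \<inter> c' = {}" if c: "c \<in> edges G" "c' \<in> edges G" "c \<noteq> c'" for c c'
    proof -
      have *: "b = {x, alp G x}" if b: "b \<in> edges G" "x \<in> b" for b x
      proof -
        obtain d where d: "d \<in> darts G" "b = {d, alp G d}" using b(1) unfolding edges_def edge_of_def by blast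
        then show ?thesis using b(2) a[OF d(1)] by auto
      qed
      show ?thesis
      proof (rule ccontr)
        assume "c \<inter> c' \<noteq> {}"
        then obtain x where "x \<in> c" "x \<in> c'" by blast
        then have "c = {x, alp G x}" "c' = {x, alp G x}" using * c(1,2) by blast+
        then show False using c(3) by simp
      qed
    qed
  qed (use fin un in \<open>auto simp: edges_def\<close>)
  then show ?thesis using e un by simp
qed

definition match_set :: "'d set \<Rightarrow> 'd set \<Rightarrow> ('d \<times> hk) set" where
  "match_set P Q = (\<lambda>d. (d, Prim)) ` P \<union> (\<lambda>d. (d, Dual)) ` Q"

lemma match_set_iff [simp]: "(d, Prim) \<in> match_set P Q \<longleftrightarrow> d \<in> P" "(d, Dual) \<in> match_set P Q \<longleftrightarrow> d \<in> Q"
  by (auto simp: match_set_def)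

lemma match_set_eqI:
  assumes "\<And>d. (d, Prim) \<in> M \<longleftrightarrow> d \<in> P" "\<And>d. (d, Dual) \<in> M \<longleftrightarrow> d \<in> Q"
  shows "M = match_set P Q"
proof (rule set_eqI)
  fix g :: "'a \<times> hk"
  obtain d k where "g = (d, k)" by force
  then show "g \<in> M \<longleftrightarrow> g \<in> match_set P Q" using assms by (cases k) auto
qed

locale rooted_plane =
  fixes G :: "'d emb" and d0 :: 'd
  assumes map: "plane_map G" and d0: "d0 \<in> darts G"
    and root: "vert_of G d0 = root G" and outer: "face_of G d0 = outer G"

sublocale rooted_plane \<subseteq> cmap "darts G" "alp G" "sig G" "vert_of G" "face_of G" d0
  by (rule plane_map_cmap[OF map d0])

context rooted_plane
begin

lemma edge_of_eq_iff: "d \<in> darts G \<Longrightarrow> e \<in> darts G \<Longrightarrow> edge_of G e = edge_of G d \<longleftrightarrow> e = d \<or> e = alp G d"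
  unfolding edge_of_def by (metis a_inv doubleton_eq_iff)

lemma edge_of_alp [simp]: "d \<in> darts G \<Longrightarrow> edge_of G (alp G d) = edge_of G d"
  by (auto simp: edge_of_def)

definition darts_over where "darts_over T = {d \<in> darts G. edge_of G d \<in> T}"

lemma darts_over_remove: "d \<in> darts G \<Longrightarrow> darts_over (T - {edge_of G d}) = darts_over T - {d, alp G d}"
  unfolding darts_over_def using edge_of_eq_iff by auto

lemma rtrancl_reach:
  fixes f :: "'d \<Rightarrow> 'x"
  assumes B: "B \<subseteq> darts G" "\<And>d. d \<in> B \<Longrightarrow> alp G d \<in> B"
  shows "(u, v) \<in> {(f d, f (alp G d)) |d. d \<in> B}\<^sup>* \<longleftrightarrow> v \<in> reach (alp G) f u B"
proof
  assume "(u, v) \<in> {(f d, f (alp G d)) |d. d \<in> B}\<^sup>*"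
  then show "v \<in> reach (alp G) f u B"
  proof induction
    case (step x y)
    then obtain d where d: "d \<in> B" "x = f d" "y = f (alp G d)" by auto
    have "f (alp G d) \<in> reach (alp G) f u B"
      by (rule reach.step) (use d B step.IH in auto)
    then show ?case using d by simp
  qed (rule reach.root)
next
  assume "v \<in> reach (alp G) f u B"
  then show "(u, v) \<in> {(f d, f (alp G d)) |d. d \<in> B}\<^sup>*"
  proof induction
    case (step d)
    have "f d = f (alp G (alp G d))" using step B by auto
    then have "(f (alp G d), f d) \<in> {(f d, f (alp G d)) |d. d \<in> B}" using step B by blast
    then show ?case using step.IH by (rule rtrancl_into_rtrancl[rotated])
  qed simp
qed

lemma darts_over_closed: "darts_over T \<subseteq> darts G" "d \<in> darts_over T \<Longrightarrow> alp G d \<in> darts_over T"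
  by (auto simp: darts_over_def)

lemma conn_iff: "conn G T u v \<longleftrightarrow> v \<in> reach (alp G) (vert_of G) u (darts_over T)"
proof -
  have "tree_rel G T = {(vert_of G d, vert_of G (alp G d)) |d. d \<in> darts_over T}"
    by (auto simp: tree_rel_def darts_over_def)
  then show ?thesis unfolding conn_def using rtrancl_reach[OF darts_over_closed, where f="vert_of G"] by simp
qed

lemma dual_iff: "(f, outer G) \<in> (dual_rel G C)\<^sup>* \<longleftrightarrow> f \<in> reachF (darts G - darts_over C)"
proof -
  have B: "darts G - darts_over C \<subseteq> darts G" "\<And>d. d \<in> darts G - darts_over C \<Longrightarrow> alp G d \<in> darts G - darts_over C"
    by (auto simp: darts_over_def)
  have "dual_rel G C = {(face_of G d, face_of G (alp G d)) |d. d \<in> darts G - darts_over C}"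
    by (auto simp: dual_rel_def darts_over_def)
  then have "(f, outer G) \<in> (dual_rel G C)\<^sup>* \<longleftrightarrow> outer G \<in> reach (alp G) (face_of G) f (darts G - darts_over C)"
    using rtrancl_reach[OF B, of f "outer G" "face_of G"] by simp
  also have "\<dots> \<longleftrightarrow> f \<in> reachF (darts G - darts_over C)"
    unfolding outer using cmap.reach_sym[OF dual B] by blast
  finally show ?thesis .
qed

lemma span_tree_darts_over:
  assumes "spanning_tree G T"
  shows "span_tree (darts_over T)"
proof -
  have "root G \<in> verts G" using root d0 by (auto simp: verts_def)
  then have "V \<subseteq> reachV (darts_over T)"
    using assms unfolding root by (auto simp: spanning_tree_def conn_iff verts_def)
  moreover have "vert_of G (alp G d) \<notin> reach (alp G) (vert_of G) (vert_of G d) (darts_over T - {d, alp G d})"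
    if "d \<in> darts_over T" for d
  proof -
    have "d \<in> darts G" "edge_of G d \<in> T" using that by (auto simp: darts_over_def)
    then show ?thesis using assms darts_over_remove[of d T] by (auto simp: spanning_tree_def conn_iff)
  qed
  ultimately show ?thesis using darts_over_closed by (auto simp: span_tree_def)
qed

lemma darts_over_fund_cycle:
  assumes "d \<in> darts G"
  shows "darts_over (fund_cycle G T d) = cycle_darts (darts_over T) d"
proof -
  have "e \<in> darts_over (fund_cycle G T d) \<longleftrightarrow> e \<in> cycle_darts (darts_over T) d" if "e \<in> darts G" for e
  proof -
    have "edge_of G e \<in> fund_cycle G T d \<longleftrightarrow> e = d \<or> e = alp G d \<or>
      edge_of G e \<in> T \<and> \<not> conn G (T - {edge_of G e}) (vert_of G (alp G d)) (vert_of G d)"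
      using edge_of_eq_iff[OF assms that] by (simp add: fund_cycle_def tree_path_edges_def)
    then show ?thesis using that unfolding conn_iff darts_over_remove[OF that]
      by (simp add: cycle_darts_def darts_over_def)
  qed
  moreover have "cycle_darts (darts_over T) d \<subseteq> darts G" using assms by (auto simp: cycle_darts_def darts_over_def)
  ultimately show ?thesis using darts_over_closed(1) by blast
qed

text \<open>The pair consists of the parent darts of the tree and the dual arborescence of the
  cotree. Away from the root means against a parent dart; counterclockwise means that the left face
  is cut off from the outer face.\<close>

lemma tree_orient_pm:
  assumes T: "spanning_tree G T"
  obtains P Q where "pm P Q" "tree_orient G T = ori P Q" "temperley G T = match_set P Q"
proof -
  let ?T = "darts_over T"
  note sp = span_tree_darts_over[OF T]
  have "2 * card V + 2 * card F = card (darts G) + 4"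
    using plane_map_euler[OF map] by (simp add: verts_def faces_def)
  then obtain Q where pm: "pm (parent_darts ?T) Q" and QT: "Q \<union> alp G ` Q = darts G - ?T"
    using tree_pm[OF sp] by blast
  have o: "d \<in> tree_orient G T \<longleftrightarrow> d \<in> ori (parent_darts ?T) Q" if d: "d \<in> darts G" for d
  proof (cases "d \<in> ?T")
    case True
    then have "d \<in> tree_orient G T \<longleftrightarrow> vert_of G d \<in> reachV (?T - {d, alp G d})"
      using d unfolding darts_over_remove[OF d, symmetric] root conn_iff[symmetric]
      by (simp add: tree_orient_def darts_over_def)
    also have "\<dots> \<longleftrightarrow> alp G d \<in> parent_darts ?T" using parent_darts_iff[OF sp True] True by (auto simp: parent_darts_def)
    also have "\<dots> \<longleftrightarrow> d \<in> ori (parent_darts ?T) Q" using True QT d by (auto simp: ori_def)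
    finally show ?thesis .
  next
    case False
    then have "d \<in> tree_orient G T \<longleftrightarrow> face_of G d \<notin> reachF (darts G - cycle_darts ?T d)"
      using d unfolding darts_over_fund_cycle[OF d, symmetric] by (simp add: tree_orient_def dual_iff darts_over_def[of T])
    also have "\<dots> \<longleftrightarrow> d \<in> Q"
    proof (cases "d \<in> Q")
      case True
      then show ?thesis using cotree_orientation(2)[OF sp pm QT True] by simp
    next
      case nQ: False
      \<comment> \<open>The reverse of \<open>d\<close> is in \<open>Q\<close>, and the left face of
        \<open>d\<close> is the right face of this reverse, which stays joined to the outer
        face.\<close>
      have "d \<in> Q \<union> alp G ` Q" using QT False d by simp
      then have "alp G d \<in> Q" using nQ pmD(4)[OF pm] by auto
      from cotree_orientation(1)[OF sp pm QT this] show ?thesis using nQ d cycle_darts_sym[OF sp d] by simp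
    qed
    also have "\<dots> \<longleftrightarrow> d \<in> ori (parent_darts ?T) Q" using False d darts_over_closed(2)[of "alp G d" T] by (auto simp: ori_def parent_darts_def)
    finally show ?thesis .
  qed
  have "tree_orient G T \<subseteq> darts G" by (auto simp: tree_orient_def)
  then have or: "tree_orient G T = ori (parent_darts ?T) Q" using o by (auto simp: ori_def)
  have "temperley G T = match_set (parent_darts ?T) Q"
  proof (rule match_set_eqI)
    fix d
    have up: "parent_darts ?T \<subseteq> ?T" by (auto simp: parent_darts_def)
    have "d \<in> parent_darts ?T \<longleftrightarrow> d \<in> ?T \<and> d \<notin> ori (parent_darts ?T) Q"
    proof (cases "d \<in> ?T")
      case True
      then have "alp G d \<in> ?T" "d \<in> darts G" using darts_over_closed(2) by (auto simp: darts_over_def)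
      moreover have "d \<notin> Q" using QT True by blast
      ultimately show ?thesis using parent_darts_iff[OF sp True] True by (auto simp: ori_def)
    qed (use up in auto)
    moreover have "vert_of G d \<noteq> root G" if "d \<in> parent_darts ?T" using pmD(3)[OF pm] that root by auto
    ultimately show "(d, Prim) \<in> temperley G T \<longleftrightarrow> d \<in> parent_darts ?T"
      by (auto simp: temperley_def plus_edges_def is_pos_def white_end_def or darts_over_def)
    have "d \<in> Q \<longleftrightarrow> d \<in> darts G - ?T \<and> d \<in> ori (parent_darts ?T) Q"
    proof (cases "d \<in> darts G - ?T")
      case True
      then show ?thesis using up darts_over_closed(2)[of "alp G d" T] by (auto simp: ori_def)
    qed (use QT in blast)
    moreover have "face_of G d \<noteq> outer G" if "d \<in> Q" using pmD(6)[OF pm] that outer by auto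
    ultimately show "(d, Dual) \<in> temperley G T \<longleftrightarrow> d \<in> Q"
      by (auto simp: temperley_def plus_edges_def is_pos_def white_end_def or darts_over_def)
  qed
  then show ?thesis using that[OF pm or] by blast
qed

end

section \<open>The Kasteleyn cokernel\<close>

context rooted_plane
begin

section \<open>Perfect matchings of the superimposed graph and pairs of dart sets\<close>

lemma plus_edges_iff [simp]:
  "(d, Prim) \<in> plus_edges G \<longleftrightarrow> d \<in> darts G \<and> vert_of G d \<noteq> root G"
  "(d, Dual) \<in> plus_edges G \<longleftrightarrow> d \<in> darts G \<and> face_of G d \<noteq> outer G"
  by (auto simp: plus_edges_def)

lemma pm_match_set:
  assumes pm: "pm P Q"
  shows "perfect_matching G (match_set P Q)"
  unfolding perfect_matching_def
proof (intro conjI ballI)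
  show "match_set P Q \<subseteq> plus_edges G"
  proof
    fix g assume g: "g \<in> match_set P Q"
    obtain e k where "g = (e, k)" by force
    then show "g \<in> plus_edges G"
      using g pmD(1,3,4,6)[OF pm] root outer by (cases k) auto
  qed
  note D = pmD(1)[OF pm, THEN subsetD] pmD(4)[OF pm, THEN subsetD]
  fix w assume "w \<in> white_verts G"
  then obtain d where d: "d \<in> darts G" "w = edge_of G d" by (auto simp: white_verts_def edges_def)
  have iff: "g \<in> match_set P Q \<and> white_end G g = w \<longleftrightarrow>
     g = (d, Prim) \<and> d \<in> P \<or> g = (alp G d, Prim) \<and> alp G d \<in> P \<or> g = (d, Dual) \<and> d \<in> Q \<or> g = (alp G d, Dual) \<and> alp G d \<in> Q" for g
  proof -
    obtain e k where g: "g = (e, k)" by force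
    show ?thesis
      using edge_of_eq_iff[OF d(1), of e] D[of e] d by (cases k) (auto simp: g white_end_def)
  qed
  show "\<exists>!g. g \<in> match_set P Q \<and> white_end G g = w"
  proof -
    note ex = pm_iff(1-6)[OF pm d(1)]
    consider "d \<in> P" | "alp G d \<in> P" | "d \<in> Q" | "alp G d \<in> Q" using pm_iff(7)[OF pm d(1)] by blast
    then show ?thesis unfolding iff using ex by cases auto
  qed
next
  fix b assume b: "b \<in> black_verts G"
  show "\<exists>!g. g \<in> match_set P Q \<and> black_end G g = b"
  proof (cases b)
    case (BV v)
    then have "v \<in> V - {vert_of G d0}" using b root by (auto simp: black_verts_def verts_def)
    then have "v \<in> vert_of G ` P" using pm by (simp add: pm_def)
    then obtain d where d: "d \<in> P" "v = vert_of G d" by blast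
    show ?thesis
    proof (rule ex1I[of _ "(d, Prim)"])
      fix g assume g: "g \<in> match_set P Q \<and> black_end G g = b"
      then obtain e where e: "g = (e, Prim)" "vert_of G e = v" "e \<in> P"
        by (auto simp: match_set_def black_end_def BV)
      then show "g = (d, Prim)" using d inj_onD[OF pmD(2)[OF pm], of e d] by auto
    qed (use d BV in \<open>auto simp: black_end_def\<close>)
  next
    case (BF f)
    then have "f \<in> F - {face_of G d0}" using b outer by (auto simp: black_verts_def faces_def)
    then have "f \<in> face_of G ` Q" using pm by (simp add: pm_def)
    then obtain d where d: "d \<in> Q" "f = face_of G d" by blast
    show ?thesis
    proof (rule ex1I[of _ "(d, Dual)"])
      fix g assume g: "g \<in> match_set P Q \<and> black_end G g = b"
      then obtain e where e: "g = (e, Dual)" "face_of G e = f" "e \<in> Q"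
        by (auto simp: match_set_def black_end_def BF)
      then show "g = (d, Dual)" using d inj_onD[OF pmD(5)[OF pm], of e d] by auto
    qed (use d BF in \<open>auto simp: black_end_def\<close>)
  qed
qed

lemma perfect_matching_pm:
  assumes M: "perfect_matching G M"
  obtains P Q where "pm P Q" "M = match_set P Q"
proof -
  define P where "P = {d. (d, Prim) \<in> M}"
  define Q where "Q = {d. (d, Dual) \<in> M}"
  have MP: "M = match_set P Q" by (rule match_set_eqI) (auto simp: P_def Q_def)
  have sub: "g \<in> plus_edges G" if "g \<in> M" for g using M that by (auto simp: perfect_matching_def)
  have P: "d \<in> darts G" "vert_of G d \<noteq> root G" if "d \<in> P" for d
    using sub[of "(d, Prim)"] that by (auto simp: P_def)
  have Q: "d \<in> darts G" "face_of G d \<noteq> outer G" if "d \<in> Q" for d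
    using sub[of "(d, Dual)"] that by (auto simp: Q_def)
  have W: "\<exists>!g. g \<in> M \<and> white_end G g = edge_of G d" if "d \<in> darts G" for d
    using M that by (auto simp: perfect_matching_def white_verts_def edges_def)
  have W': "g = g'" if "g \<in> M" "g' \<in> M" "fst g \<in> darts G" "white_end G g = white_end G g'" for g g'
  proof -
    have "g \<in> M \<and> white_end G g = edge_of G (fst g)" "g' \<in> M \<and> white_end G g' = edge_of G (fst g)"
      using that by (simp_all add: white_end_def)
    then show ?thesis using W[OF that(3)] by blast
  qed
  have BV: "\<exists>!g. g \<in> M \<and> black_end G g = BV (vert_of G d)" if "d \<in> darts G" "vert_of G d \<noteq> root G" for d
  proof -
    have "BV (vert_of G d) \<in> black_verts G" using that by (auto simp: black_verts_def verts_def)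
    then show ?thesis using M by (simp add: perfect_matching_def)
  qed
  have BF: "\<exists>!g. g \<in> M \<and> black_end G g = BF (face_of G d)" if "d \<in> darts G" "face_of G d \<noteq> outer G" for d
  proof -
    have "BF (face_of G d) \<in> black_verts G" using that by (auto simp: black_verts_def faces_def)
    then show ?thesis using M by (simp add: perfect_matching_def)
  qed
  have injP: "inj_on (vert_of G) P"
  proof (rule inj_onI)
    fix d e assume d: "d \<in> P" "e \<in> P" "vert_of G d = vert_of G e"
    then have "(d, Prim) \<in> M" "(e, Prim) \<in> M" by (auto simp: P_def)
    moreover have "black_end G (d, Prim) = BV (vert_of G d)" "black_end G (e, Prim) = BV (vert_of G d)"
      using d by (auto simp: black_end_def)
    ultimately have "(d, Prim) = (e, Prim)" using BV[OF P[OF d(1)]] by blast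
    then show "d = e" by simp
  qed
  have injQ: "inj_on (face_of G) Q"
  proof (rule inj_onI)
    fix d e assume d: "d \<in> Q" "e \<in> Q" "face_of G d = face_of G e"
    then have "(d, Dual) \<in> M" "(e, Dual) \<in> M" by (auto simp: Q_def)
    moreover have "black_end G (d, Dual) = BF (face_of G d)" "black_end G (e, Dual) = BF (face_of G d)"
      using d by (auto simp: black_end_def)
    ultimately have "(d, Dual) = (e, Dual)" using BF[OF Q[OF d(1)]] by blast
    then show "d = e" by simp
  qed
  have imP: "vert_of G ` P = V - {vert_of G d0}"
  proof
    show "vert_of G ` P \<subseteq> V - {vert_of G d0}" using P root by auto
    show "V - {vert_of G d0} \<subseteq> vert_of G ` P"
    proof
      fix v assume "v \<in> V - {vert_of G d0}"
      then obtain d where d: "d \<in> darts G" "v = vert_of G d" "vert_of G d \<noteq> root G" using root by auto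
      obtain g where g: "g \<in> M" "black_end G g = BV v" using BV[OF d(1,3)] d(2) by blast
      obtain e k where "g = (e, k)" by force
      then show "v \<in> vert_of G ` P" using g by (cases k) (auto simp: black_end_def P_def)
    qed
  qed
  have imQ: "face_of G ` Q = F - {face_of G d0}"
  proof
    show "face_of G ` Q \<subseteq> F - {face_of G d0}" using Q outer by auto
    show "F - {face_of G d0} \<subseteq> face_of G ` Q"
    proof
      fix v assume "v \<in> F - {face_of G d0}"
      then obtain d where d: "d \<in> darts G" "v = face_of G d" "face_of G d \<noteq> outer G" using outer by auto
      obtain g where g: "g \<in> M" "black_end G g = BF v" using BF[OF d(1,3)] d(2) by blast
      obtain e k where "g = (e, k)" by force
      then show "v \<in> face_of G ` Q" using g by (cases k) (auto simp: black_end_def Q_def)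
    qed
  qed
  have cover: "d \<in> P \<or> alp G d \<in> P \<or> d \<in> Q \<or> alp G d \<in> Q" if d: "d \<in> darts G" for d
  proof -
    obtain g where g: "g \<in> M" "white_end G g = edge_of G d" using W[OF d] by blast
    obtain e k where ek: "g = (e, k)" by force
    have "e \<in> darts G" using sub[OF g(1)] ek by (cases k) auto
    then have "e = d \<or> e = alp G d" using edge_of_eq_iff[OF d] g(2) ek by (auto simp: white_end_def)
    then show ?thesis using g ek by (cases k) (auto simp: P_def Q_def)
  qed
  have exP: "alp G d \<notin> P \<and> d \<notin> Q \<and> alp G d \<notin> Q" if d: "d \<in> P" for d
    using W'[of "(d, Prim)" "(alp G d, Prim)"] W'[of "(d, Prim)" "(d, Dual)"] W'[of "(d, Prim)" "(alp G d, Dual)"]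
      d P(1)[OF d] a_ne[OF P(1)[OF d]] by (auto simp: P_def Q_def white_end_def)
  have exQ: "alp G d \<notin> Q" if d: "d \<in> Q" for d
    using W'[of "(d, Dual)" "(alp G d, Dual)"] d Q(1)[OF d] a_ne[OF Q(1)[OF d]] by (auto simp: Q_def white_end_def)
  have "P \<subseteq> darts G" "Q \<subseteq> darts G" using P(1) Q(1) by blast+
  then have "pm P Q" unfolding pm_def using injP injQ imP imQ cover exP exQ by simp
  then show ?thesis using MP that by blast
qed

section \<open>Signs of matched half-edges\<close>

lemma matched_eq:
  assumes "pm P Q" "g \<in> match_set P Q" "d \<in> darts G" "white_end G g = edge_of G d"
  shows "matched G (match_set P Q) (edge_of G d) = g"
proof -
  have "edge_of G d \<in> white_verts G" using assms(3) by (auto simp: white_verts_def edges_def)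
  then have "\<exists>!g. g \<in> match_set P Q \<and> white_end G g = edge_of G d"
    using pm_match_set[OF assms(1)] by (simp add: perfect_matching_def)
  then show ?thesis unfolding matched_def using assms by (blast intro: the1_equality)
qed

text \<open>The matching is positive for \<open>ori P Q\<close>, so the sign of its half-edge for
  \<open>U\<close> tells whether the two orientations agree at the edge.\<close>

lemma is_pos_matched:
  assumes pm: "pm P Q" and U: "orient (darts G) (alp G) U" and d: "d \<in> U"
  shows "is_pos U (matched G (match_set P Q) (edge_of G d)) \<longleftrightarrow> d \<in> ori P Q"
proof -
  have dD: "d \<in> darts G" "alp G d \<notin> U" using U d by (auto simp: orient_def)
  note m = matched_eq[OF pm _ dD(1)]
  consider "d \<in> P" | "alp G d \<in> P" | "d \<in> Q" | "alp G d \<in> Q" using pm_iff(7)[OF pm dD(1)] by blast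
  then show ?thesis
  proof cases
    case 1
    then show ?thesis using m[of "(d, Prim)"] ori_iff[OF pm dD(1)] d by (simp add: white_end_def is_pos_def)
  next
    case 2
    then show ?thesis using m[of "(alp G d, Prim)"] d dD by (simp add: white_end_def is_pos_def ori_def)
  next
    case 3
    then show ?thesis using m[of "(d, Dual)"] d dD by (simp add: white_end_def is_pos_def ori_def)
  next
    case 4
    then show ?thesis using m[of "(alp G d, Dual)"] ori_iff[OF pm dD(1)] dD by (simp add: white_end_def is_pos_def)
  qed
qed

text \<open>The reference matching is positive throughout in its own orientation, so opposite signs
  at a white vertex mean that \<open>ori P Q\<close> reverses the edge.\<close>

lemma psi_vec_eq:
  assumes pm0: "pm P0 Q0" and pm: "pm P Q" and d: "d \<in> ori P0 Q0"
  shows "psi_vec G (ori P0 Q0) (match_set P0 Q0) (match_set P Q) (edge_of G d) = of_bool (d \<notin> ori P Q)"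
proof -
  note U = ori_orient[OF pm0]
  have dD: "d \<in> darts G" using d by (auto simp: ori_def)
  then have "edge_of G d \<in> white_verts G" by (auto simp: white_verts_def edges_def)
  then show ?thesis
    using is_pos_matched[OF pm0 U d] is_pos_matched[OF pm U d] d unfolding psi_vec_def by auto
qed

section \<open>Kasteleyn rows as coboundaries\<close>

lemma finite_plus: "finite (plus_edges G)"
proof -
  have "plus_edges G \<subseteq> darts G \<times> {Prim, Dual}" by (auto simp: plus_edges_def)
  then show ?thesis using fin by (meson finite.intros finite_SigmaI finite_subset)
qed

text \<open>At the edge of \<open>d\<close> four half-edges count: sign 1 at the head and the left
  face, sign -1 at the tail and the right face. The deleted root and outer face enter with value
  0.\<close>

lemma kast_combination:
  assumes U: "orient (darts G) (alp G) U" and d: "d \<in> U"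
  shows "(\<Sum>b\<in>black_verts G. c b * kast_row G U b (edge_of G d)) =
    cob (alp G) (vert_of G) (\<lambda>v. if v = root G then 0 else c (BV v)) d +
    cob (alp G) (face_of G) (\<lambda>f. if f = outer G then 0 else - c (BF f)) d"
proof -
  have dD: "d \<in> darts G" "alp G d \<notin> U" using U d by (auto simp: orient_def)
  let ?A = "{g \<in> plus_edges G. white_end G g = edge_of G d}"
  let ?s = "\<lambda>g. if is_pos U g then 1 else - 1 :: int"
  have finB: "finite (black_verts G)" using fin by (simp add: black_verts_def verts_def faces_def)
  have AB: "black_end G ` ?A \<subseteq> black_verts G"
    by (auto simp: black_end_def black_verts_def plus_edges_def verts_def faces_def)
  have "c b * kast_row G U b (edge_of G d) = (\<Sum>g\<in>{g\<in>?A. black_end G g = b}. c (black_end G g) * ?s g)" for b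
    unfolding kast_row_def sum_distrib_left by (rule sum.cong) auto
  then have "(\<Sum>b\<in>black_verts G. c b * kast_row G U b (edge_of G d)) =
      (\<Sum>b\<in>black_verts G. \<Sum>g\<in>{g\<in>?A. black_end G g = b}. c (black_end G g) * ?s g)" by simp
  also have "\<dots> = (\<Sum>g\<in>?A. c (black_end G g) * ?s g)"
    by (rule sum.group) (use finite_plus finB AB in auto)
  also have "\<dots> = (\<Sum>g\<in>{g\<in>{(d, Prim), (alp G d, Prim), (d, Dual), (alp G d, Dual)}. g \<in> plus_edges G}. c (black_end G g) * ?s g)"
  proof (rule sum.cong)
    show "?A = {g\<in>{(d, Prim), (alp G d, Prim), (d, Dual), (alp G d, Dual)}. g \<in> plus_edges G}"
    proof (rule set_eqI)
      fix g :: "'d \<times> hk"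
      obtain e k where "g = (e, k)" by force
      then show "g \<in> ?A \<longleftrightarrow> g \<in> {g\<in>{(d, Prim), (alp G d, Prim), (d, Dual), (alp G d, Dual)}. g \<in> plus_edges G}"
        using edge_of_eq_iff[OF dD(1), of e] by (cases k) (auto simp: white_end_def)
    qed
  qed simp
  also have "\<dots> = (\<Sum>g\<in>{(d, Prim), (alp G d, Prim), (d, Dual), (alp G d, Dual)}. if g \<in> plus_edges G then c (black_end G g) * ?s g else 0)"
    by (rule sum.inter_filter) simp
  also have "\<dots> = cob (alp G) (vert_of G) (\<lambda>v. if v = root G then 0 else c (BV v)) d +
    cob (alp G) (face_of G) (\<lambda>f. if f = outer G then 0 else - c (BF f)) d"
  proof -
    let ?f = "\<lambda>g. if g \<in> plus_edges G then c (black_end G g) * ?s g else 0"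
    have "(\<Sum>g\<in>{(d, Prim), (alp G d, Prim), (d, Dual), (alp G d, Dual)}. ?f g) =
      ?f (d, Prim) + (?f (alp G d, Prim) + (?f (d, Dual) + ?f (alp G d, Dual)))"
      using a_ne[OF dD(1)] by (subst sum.insert; simp)+
    also have "?f (d, Prim) = (if vert_of G d = root G then 0 else - c (BV (vert_of G d)))"
      using dD d by (simp add: black_end_def is_pos_def)
    also have "?f (alp G d, Prim) = (if vert_of G (alp G d) = root G then 0 else c (BV (vert_of G (alp G d))))"
      using dD by (simp add: black_end_def is_pos_def)
    also have "?f (d, Dual) = (if face_of G d = outer G then 0 else c (BF (face_of G d)))"
      using dD d by (simp add: black_end_def is_pos_def)
    also have "?f (alp G d, Dual) = (if face_of G (alp G d) = outer G then 0 else - c (BF (face_of G (alp G d))))"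
      using dD by (simp add: black_end_def is_pos_def)
    finally show ?thesis unfolding cob_def by simp
  qed
  finally show ?thesis .
qed

lemma Prin_iff:
  assumes U: "orient (darts G) (alp G) U" and x: "x \<in> ZW G"
  shows "x \<in> Prin G U \<longleftrightarrow> (\<exists>g h. \<forall>d\<in>U. x (edge_of G d) = cob (alp G) (vert_of G) g d + cob (alp G) (face_of G) h d)"
proof
  assume "x \<in> Prin G U"
  then obtain c where "x = (\<lambda>w. \<Sum>b\<in>black_verts G. c b * kast_row G U b w)" by (auto simp: Prin_def)
  then show "\<exists>g h. \<forall>d\<in>U. x (edge_of G d) = cob (alp G) (vert_of G) g d + cob (alp G) (face_of G) h d"
    using kast_combination[OF U, of _ c] by blast
next
  assume "\<exists>g h. \<forall>d\<in>U. x (edge_of G d) = cob (alp G) (vert_of G) g d + cob (alp G) (face_of G) h d"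
  then obtain g h where gh: "\<And>d. d \<in> U \<Longrightarrow> x (edge_of G d) = cob (alp G) (vert_of G) g d + cob (alp G) (face_of G) h d"
    by blast
  \<comment> \<open>Constants do not change a coboundary, so \<open>g\<close> and \<open>h\<close>
    are shifted to vanish at the root and the outer face; faces get the opposite sign as in
    \<open>kast_combination\<close>.\<close>
  define c where "c b = (case b of BV v \<Rightarrow> g v - g (root G) | BF f \<Rightarrow> h (outer G) - h f)" for b
  have "x w = (\<Sum>b\<in>black_verts G. c b * kast_row G U b w)" for w
  proof (cases "w \<in> edges G")
    case True
    then obtain e where e: "e \<in> darts G" "w = edge_of G e" by (auto simp: edges_def)
    then obtain d where d: "d \<in> U" "w = edge_of G d"
      using U unfolding orient_def by (metis edge_of_alp)
    show ?thesis
      unfolding d(2) kast_combination[OF U d(1)] gh[OF d(1)] by (simp add: cob_def c_def)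
  next
    case False
    then have "{g \<in> plus_edges G. white_end G g = w \<and> black_end G g = b} = {}" for b
      by (auto simp: plus_edges_def white_end_def edges_def)
    then have "kast_row G U b w = 0" for b unfolding kast_row_def by (simp only: sum.empty)
    then show ?thesis using x False by (simp add: ZW_def white_verts_def)
  qed
  then show "x \<in> Prin G U" unfolding Prin_def by blast
qed

lemma equiv_krel: "equiv (ZW G) (krel G U)"
proof (rule equivI)
  show "krel G U \<subseteq> ZW G \<times> ZW G" by (auto simp: krel_def)
  have "(\<lambda>w. 0) \<in> Prin G U"
    unfolding Prin_def by (rule CollectI, rule exI[of _ "\<lambda>_. 0"]) simp
  then show "refl_on (ZW G) (krel G U)" by (auto simp: refl_on_def krel_def)
  show "sym (krel G U)"
  proof (rule symI)
    fix x y assume xy: "(x, y) \<in> krel G U"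
    then obtain c where "(\<lambda>w. x w - y w) = (\<lambda>w. \<Sum>b\<in>black_verts G. c b * kast_row G U b w)"
      by (auto simp: krel_def Prin_def)
    then have "x w - y w = (\<Sum>b\<in>black_verts G. c b * kast_row G U b w)" for w by meson
    then have "y w - x w = (\<Sum>b\<in>black_verts G. - c b * kast_row G U b w)" for w
      by (simp add: sum_negf) (metis minus_diff_eq)
    then have "(\<lambda>w. y w - x w) \<in> Prin G U" unfolding Prin_def by (intro CollectI exI[of _ "\<lambda>b. - c b"]) blast
    then show "(y, x) \<in> krel G U" using xy by (simp add: krel_def)
  qed
  show "trans (krel G U)"
  proof (rule transI)
    fix x y z assume xy: "(x, y) \<in> krel G U" "(y, z) \<in> krel G U"
    then obtain c c' where "(\<lambda>w. x w - y w) = (\<lambda>w. \<Sum>b\<in>black_verts G. c b * kast_row G U b w)"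
      "(\<lambda>w. y w - z w) = (\<lambda>w. \<Sum>b\<in>black_verts G. c' b * kast_row G U b w)"
      by (auto simp: krel_def Prin_def)
    then have "x w - y w = (\<Sum>b\<in>black_verts G. c b * kast_row G U b w)"
      "y w - z w = (\<Sum>b\<in>black_verts G. c' b * kast_row G U b w)" for w by meson+
    then have "x w - z w = (\<Sum>b\<in>black_verts G. (c b + c' b) * kast_row G U b w)" for w
      by (simp add: distrib_right sum.distrib) (metis diff_add_cancel add_diff_eq)
    then have "(\<lambda>w. x w - z w) \<in> Prin G U" unfolding Prin_def by (intro CollectI exI[of _ "\<lambda>b. c b + c' b"]) blast
    then show "(x, z) \<in> krel G U" using xy by (simp add: krel_def)
  qed
qed

section \<open>Bijectivity on the cokernel\<close>

lemma psi_vec_ZW: "psi_vec G U M0 M \<in> ZW G"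
  by (simp add: psi_vec_def ZW_def)

lemma Psi_inj:
  assumes T: "spanning_tree G T0"
  shows "inj_on (Psi G T0) (perfect_matchings G)"
proof (rule inj_onI)
  obtain P0 Q0 where pm0: "pm P0 Q0" and U: "tree_orient G T0 = ori P0 Q0" and M0: "temperley G T0 = match_set P0 Q0"
    by (rule tree_orient_pm[OF T])
  note orient = ori_orient[OF pm0]
  fix M M' assume "M \<in> perfect_matchings G" "M' \<in> perfect_matchings G" and eq: "Psi G T0 M = Psi G T0 M'"
  then obtain P Q P' Q' where pm: "pm P Q" "pm P' Q'" and M: "M = match_set P Q" "M' = match_set P' Q'"
    using perfect_matching_pm unfolding perfect_matchings_def by (metis mem_Collect_eq)
  let ?psi = "psi_vec G (ori P0 Q0) (match_set P0 Q0)"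
  have "(?psi M, ?psi M') \<in> krel G (ori P0 Q0)"
    using eq_equiv_class[OF eq[unfolded Psi_def U M0] equiv_krel psi_vec_ZW] .
  then have "(\<lambda>w. ?psi M w - ?psi M' w) \<in> Prin G (ori P0 Q0)" by (simp add: krel_def)
  moreover have "(\<lambda>w. ?psi M w - ?psi M' w) \<in> ZW G" using psi_vec_ZW by (simp add: ZW_def)
  ultimately obtain g h where gh: "\<And>d. d \<in> ori P0 Q0 \<Longrightarrow> ?psi M (edge_of G d) - ?psi M' (edge_of G d) =
      cob (alp G) (vert_of G) g d + cob (alp G) (face_of G) h d"
    using Prin_iff[OF orient] by blast
  have *: "of_bool (d \<in> ori P' Q') - of_bool (d \<in> ori P Q) =
      cob (alp G) (vert_of G) g d + cob (alp G) (face_of G) h d" if "d \<in> ori P0 Q0" for d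
    using gh[OF that] unfolding M psi_vec_eq[OF pm0 pm(1) that] psi_vec_eq[OF pm0 pm(2) that]
    by (auto simp: of_bool_def split: if_splits)
  \<comment> \<open>Both sides change sign when \<open>d\<close> is replaced by its reverse, so the
    identity extends from the reference darts to all darts.\<close>
  have "of_bool (d \<in> ori P' Q') - of_bool (d \<in> ori P Q) =
      cob (alp G) (vert_of G) g d + cob (alp G) (face_of G) h d" if d: "d \<in> darts G" for d
  proof (cases "d \<in> ori P0 Q0")
    case False
    then have "alp G d \<in> ori P0 Q0" using orient d by (auto simp: orient_def)
    moreover have "alp G d \<in> ori P Q \<longleftrightarrow> d \<notin> ori P Q" "alp G d \<in> ori P' Q' \<longleftrightarrow> d \<notin> ori P' Q'"
      using ori_orient[OF pm(1)] ori_orient[OF pm(2)] d by (auto simp: orient_def)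
    ultimately show ?thesis using *[of "alp G d"] d by (auto simp: cob_def of_bool_def split: if_splits)
  qed (rule *)
  from pm_injective[OF pm this] show "M = M'" by (simp add: M)
qed

lemma Psi_image:
  assumes T: "spanning_tree G T0"
  shows "Psi G T0 ` perfect_matchings G = kcoker G (tree_orient G T0)"
proof
  show "Psi G T0 ` perfect_matchings G \<subseteq> kcoker G (tree_orient G T0)"
    unfolding Psi_def kcoker_def by (auto intro: quotientI psi_vec_ZW)
  obtain P0 Q0 where pm0: "pm P0 Q0" and U: "tree_orient G T0 = ori P0 Q0" and M0: "temperley G T0 = match_set P0 Q0"
    by (rule tree_orient_pm[OF T])
  note orient = ori_orient[OF pm0]
  show "kcoker G (tree_orient G T0) \<subseteq> Psi G T0 ` perfect_matchings G"
  proof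
    fix X assume "X \<in> kcoker G (tree_orient G T0)"
    then obtain x where x: "x \<in> ZW G" and X: "X = krel G (ori P0 Q0) `` {x}"
      unfolding kcoker_def U by (auto elim: quotientE)
    \<comment> \<open>The chain at distance \<open>x\<close> from the reference orientation: value 0
      of \<open>x\<close> keeps an edge and value 1 reverses it.\<close>
    define u where "u d = (if d \<in> ori P0 Q0 then 1 - x (edge_of G d) else x (edge_of G d))" for d
    have "u d + u (alp G d) = 1" if "d \<in> darts G" for d
      using orient that by (auto simp: u_def orient_def)
    from pm_surjective[where u=u, OF pm0 this] obtain P Q g h where pm: "pm P Q"
      and gh: "\<And>d. d \<in> darts G \<Longrightarrow> of_bool (d \<in> ori P Q) - u d =
        cob (alp G) (vert_of G) g d + cob (alp G) (face_of G) h d" by blast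
    let ?psi = "psi_vec G (ori P0 Q0) (match_set P0 Q0) (match_set P Q)"
    have "?psi (edge_of G d) - x (edge_of G d) = cob (alp G) (vert_of G) (\<lambda>v. - g v) d + cob (alp G) (face_of G) (\<lambda>f. - h f) d"
      if "d \<in> ori P0 Q0" for d
    proof -
      have "d \<in> darts G" using that by (simp add: ori_def)
      from gh[OF this] show ?thesis
        using that unfolding psi_vec_eq[OF pm0 pm that] by (auto simp: u_def cob_def of_bool_def split: if_splits)
    qed
    moreover have "(\<lambda>w. ?psi w - x w) \<in> ZW G" using psi_vec_ZW x by (simp add: ZW_def)
    ultimately have "(\<lambda>w. ?psi w - x w) \<in> Prin G (ori P0 Q0)" using Prin_iff[OF orient] by blast
    then have "(?psi, x) \<in> krel G (ori P0 Q0)" using psi_vec_ZW x by (simp add: krel_def)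
    from equiv_class_eq[OF equiv_krel this] have "Psi G T0 (match_set P Q) = X"
      by (simp add: Psi_def U M0 X)
    moreover have "match_set P Q \<in> perfect_matchings G" using pm_match_set[OF pm] by (simp add: perfect_matchings_def)
    ultimately show "X \<in> Psi G T0 ` perfect_matchings G" by blast
  qed
qed

end

theorem theorem3p2:
  fixes G :: "'d emb" and T0 :: "'d set set"
  assumes "plane_graph G" and "spanning_tree G T0"
  shows "bij_betw (Psi G T0) (perfect_matchings G) (kcoker G (tree_orient G T0)) \<and>
         Psi G T0 (temperley G T0) = krel G (tree_orient G T0) `` {\<lambda>w. 0}"
proof -
  obtain d0 where "rooted_plane G d0"
    using assms(1) by (auto simp: plane_graph_def rooted_plane_def)
  then interpret rooted_plane G d0 .
  have "psi_vec G U M M = (\<lambda>w. 0)" for U M by (auto simp: psi_vec_def)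
  then show ?thesis
    using Psi_inj[OF assms(2)] Psi_image[OF assms(2)] by (simp add: bij_betw_def Psi_def)
qed

end
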